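(* Let $k$ be a field of characteristic $\neq 2$ and let $F=k(t,u)=k(x,y)$ be a hyperelliptic function field of genus $g$ over $k$, where $u^2=D_t(t)$ and $y^2=D_x(x)$ with $D_t\in k[t]$ and $D_x\in k[x]$ monic separable polynomials. Let $d_x:=\deg_x(D_x)$. (1) If $x\in k[t]$, then there are $\alpha_0,\alpha_1\in k$ with $\alpha_0\neq 0$ such that $x=\alpha_0t+\alpha_1$. Furthermore $y=\varphi u$ with $\varphi\in k\setminus\{0\}$ and $\varphi^2=\alpha_0^{d_x}$. (2) If $x\notin k[t]$, then there are $\alpha_0,\alpha_1,\alpha_3\in k$ with $\alpha_0\alpha_3-\alpha_1\neq 0$ such that $x=\frac{\alpha_0t+\alpha_1}{t+\alpha_3}$. Furthermore $y=\varphi u$ where \[ \varphi=\frac{\beta}{(t+\alpha_3)^{g+1}} \] with $\beta\in k\setminus\{0\}$, and \[ \beta^2=\begin{cases} D_x(\alpha_0), & \text{if } D_x(\alpha_0)\neq 0,\\ (\alpha_1-\alpha_0\alpha_3)\,\tilde D_x(\alpha_0), & \text{if } D_x(\alpha_0)=0,\end{cases} \] where $\tilde D_x(x):=\frac{D_x(x)}{x-\alpha_0}$.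
   Context: A hyperelliptic function field of genus $g$ (with $g\in\mathbb{N}$, $g>1$) over $k$ is a field $F=k(x,y)$ such that $x$ is transcendental over $k$ and $y^2=D(x)$, where $D\in k[x]$ is a monic separable polynomial of degree $2g+1$ or $2g+2$. A presentation $F=k(t,u)$ with $u^2=D_t(t)$ means $t$ is transcendental over $k$, $D_t$ is monic separable of degree $2g+1$ or $2g+2$, and $F=k(t,u)$. *)

theory Defs
  imports "HOL-Algebra.Algebraic_Closure_Type"
begin

text \<open>
  An extension \<open>F/k\<close> of fields is an embedding \<open>\<iota>\<close> of the field \<open>k\<close> (the type \<open>'k\<close>) into the
  field \<open>F\<close> (the type \<open>'f\<close>); a polynomial over \<open>k\<close> is evaluated at an element of \<open>F\<close> via \<open>\<iota>\<close>.
\<close>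

locale field_embedding =
  fixes \<iota> :: "'k::field \<Rightarrow> 'f::field"
  assumes emb_one: "\<iota> 1 = 1"
    and emb_add: "\<iota> (a + b) = \<iota> a + \<iota> b"
    and emb_mult: "\<iota> (a * b) = \<iota> a * \<iota> b"

definition eval_over :: "('k::field \<Rightarrow> 'f::field) \<Rightarrow> 'k poly \<Rightarrow> 'f \<Rightarrow> 'f" where
  "eval_over \<iota> p x = poly (map_poly \<iota> p) x"

definition transcendental_over :: "('k::field \<Rightarrow> 'f::field) \<Rightarrow> 'f \<Rightarrow> bool" where
  "transcendental_over \<iota> x \<longleftrightarrow> (\<forall>p. eval_over \<iota> p x = 0 \<longrightarrow> p = 0)"

definition ring_adjoin :: "('k::field \<Rightarrow> 'f::field) \<Rightarrow> 'f \<Rightarrow> 'f set" where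
  "ring_adjoin \<iota> x = range (\<lambda>p. eval_over \<iota> p x)"

definition subfield_set :: "'f::field set \<Rightarrow> bool" where
  "subfield_set S \<longleftrightarrow> 1 \<in> S \<and> (\<forall>a\<in>S. \<forall>b\<in>S. a - b \<in> S \<and> a * b \<in> S) \<and> (\<forall>a\<in>S. inverse a \<in> S)"

definition field_adjoin :: "('k::field \<Rightarrow> 'f::field) \<Rightarrow> 'f set \<Rightarrow> 'f set" where
  "field_adjoin \<iota> A = subfield_set hull (range \<iota> \<union> A)"

text \<open>Separable: no multiple root in an algebraic closure (irreducibility is not required).\<close>

definition separable_poly :: "'k::field poly \<Rightarrow> bool" where
  "separable_poly p \<longleftrightarrow> rsquarefree (map_poly to_ac p)"

text \<open>\<open>F = k(x,y)\<close> with \<open>y\<^sup>2 = D(x)\<close>, where \<open>F\<close> is the whole type \<open>'f\<close>.\<close>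

definition hyperelliptic_presentation ::
    "('k::field \<Rightarrow> 'f::field) \<Rightarrow> nat \<Rightarrow> 'k poly \<Rightarrow> 'f \<Rightarrow> 'f \<Rightarrow> bool" where
  "hyperelliptic_presentation \<iota> g D x y \<longleftrightarrow>
     transcendental_over \<iota> x \<and>
     lead_coeff D = 1 \<and> separable_poly D \<and>
     (Polynomial.degree D = 2 * g + 1 \<or> Polynomial.degree D = 2 * g + 2) \<and>
     y\<^sup>2 = eval_over \<iota> D x \<and>
     field_adjoin \<iota> {x, y} = UNIV"

end

theory Submission
  imports Defs
begin

text \<open>
  A differential \<open>\<omega> = x\<^sup>i dx / y\<close> with \<open>i < g\<close> is regular everywhere on the curve. Hence \<open>\<omega> = (A + B u) dt / u\<close>
  with polynomials \<open>A\<close> and \<open>B\<close> in \<open>t\<close>, and regularity at \<open>t = \<infinity>\<close> forces \<open>B = 0\<close> and \<open>deg A < g\<close>.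
  Writing \<open>A\<^sub>i\<close> for the polynomial that belongs to \<open>i\<close>, we get \<open>x = A\<^sub>1 / A\<^sub>0 = p / q\<close> in lowest terms, and
  \<open>x\<^bsup>g-1\<^esup> = A\<^bsub>g-1\<^esub> / A\<^sub>0\<close> shows that \<open>p\<^bsup>g-1\<^esup>\<close> and \<open>q\<^bsup>g-1\<^esup>\<close> divide polynomials of degree less than \<open>g\<close>.
  So \<open>p\<close> and \<open>q\<close> are linear and \<open>A\<^sub>0\<close> is a constant times \<open>q\<^bsup>g-1\<^esup>\<close>, whence \<open>y = (dx / dt) u / A\<^sub>0\<close> is a constant times
  \<open>u / q\<^bsup>g+1\<^esup>\<close>; the constant is found by comparing leading coefficients in \<open>y\<^sup>2 = D\<^sub>x(x)\<close>.

  Regularity is proved without places. With the derivation \<open>d\<close> such that \<open>d t = u\<close>, the claim is that \<open>x\<^sup>i d x / y\<close>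
  lies in \<open>R = k[t] + k[t] u\<close>. If \<open>M E + N E' = 1\<close> and \<open>y\<^sup>2 = E(x)\<close>, then \<open>d x / y = M(x) y d x + 2 N(x) d y\<close>, so for
  every fraction \<open>x = \<alpha> / \<beta>\<close> over \<open>R\<close> the element lies in \<open>R[1/\<beta>]\<close>, and by the symmetry \<open>x \<mapsto> 1/x\<close>,
  \<open>y \<mapsto> y / x\<^bsup>g+1\<^esup>\<close> also in \<open>R[1/\<alpha>]\<close>. Finally \<open>x\<close> has two such fractions whose numerators and denominators
  generate the unit ideal of \<open>R\<close>.
\<close>

section \<open>Polynomials over a field\<close>

text \<open>Coprimality is kept as a Bezout identity, because such an identity can be evaluated at
  an element of F.\<close>

definition comaximal :: "'a::comm_ring_1 \<Rightarrow> 'a \<Rightarrow> bool" where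
  "comaximal p q \<longleftrightarrow> (\<exists>a b. a * p + b * q = 1)"

lemma comaximal_commute: "comaximal p q \<Longrightarrow> comaximal q p"
  unfolding comaximal_def by (metis add.commute)

lemma comaximal_mult_right:
  assumes "comaximal p q" "comaximal p r"
  shows "comaximal p (q * r)"
proof -
  obtain a b c d where "a * p + b * q = 1" "c * p + d * r = 1"
    using assms unfolding comaximal_def by blast
  then have "(a * p + b * q) * (c * p + d * r) = 1" by simp
  then have "(a * (c * p + d * r) + b * q * c) * p + (b * d) * (q * r) = 1"
    by (simp add: algebra_simps)
  then show ?thesis unfolding comaximal_def by blast
qed

lemma comaximal_power_right: "comaximal p q \<Longrightarrow> comaximal p (q ^ n)"
proof (induction n)
  case 0
  have "0 * p + 1 * q ^ 0 = 1" by simp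
  then show ?case unfolding comaximal_def by blast
qed (auto intro: comaximal_mult_right)

lemma comaximal_power: "comaximal p q \<Longrightarrow> comaximal (p ^ m) (q ^ n)"
  by (intro comaximal_power_right) (metis comaximal_commute comaximal_power_right)

lemma comaximal_dvd_mult:
  assumes "comaximal p q" "p dvd q * r"
  shows "p dvd r"
proof -
  obtain a b where ab: "a * p + b * q = 1"
    using assms unfolding comaximal_def by blast
  have "r = (a * p + b * q) * r" using ab by simp
  also have "\<dots> = p * (a * r) + b * (q * r)" by (simp add: algebra_simps)
  finally show ?thesis using assms(2) by (metis dvd_add dvd_mult dvd_triv_left)
qed

lemma poly_bezout:
  fixes p q :: "'a::field poly"
  obtains d a b where "d = a * p + b * q" "d dvd p" "d dvd q"
proof -
  have "\<exists>d a b. d = a * p + b * q \<and> d dvd p \<and> d dvd q"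
  proof (induction "euclidean_size q" arbitrary: p q rule: less_induct)
    case less
    show ?case
    proof (cases "q = 0")
      case True
      have "p = 1 * p + 0 * q" by simp
      then show ?thesis using True by (metis dvd_0_right dvd_refl)
    next
      case False
      from less[of "p mod q" q] obtain d a b
        where d: "d = a * q + b * (p mod q)" "d dvd q" "d dvd p mod q"
        using mod_size_less[OF False] by blast
      have "d = b * p + (a - b * (p div q)) * q"
        unfolding d(1) by (simp add: minus_div_mult_eq_mod[symmetric] algebra_simps)
      moreover have "d dvd p" using d(2,3) by (simp add: dvd_mod_iff)
      ultimately show ?thesis using d(2) by blast
    qed
  qed
  then show ?thesis using that by blast
qed

lemma poly_bezout_cofactors:
  fixes p q :: "'a::field poly"
  assumes "p \<noteq> 0 \<or> q \<noteq> 0"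
  obtains d p' q' where "d \<noteq> 0" "p = d * p'" "q = d * q'" "comaximal p' q'"
proof -
  obtain d a b where d: "d = a * p + b * q" "d dvd p" "d dvd q" by (rule poly_bezout)
  then obtain p' q' where pq: "p = d * p'" "q = d * q'" by (meson dvdE)
  have d0: "d \<noteq> 0" using assms pq by auto
  have "d * (a * p' + b * q') = d * 1" using d(1) pq by (simp add: algebra_simps)
  then have "a * p' + b * q' = 1" using d0 by (metis mult_cancel_left)
  then show ?thesis using that d0 pq unfolding comaximal_def by blast
qed

text \<open>Once the common factor \<open>d\<close> is removed, \<open>c'\<^sup>2\<close> is
  comaximal to \<open>b'\<^sup>2\<close> and so divides \<open>D\<close>. Then \<open>c'\<close>
  divides both \<open>D\<close> and its derivative, hence is a unit.\<close>

lemma square_dvd_square_times_squarefree: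
  fixes b c D :: "'a::field poly"
  assumes "comaximal D (pderiv D)" "c\<^sup>2 dvd b\<^sup>2 * D"
  shows "c dvd b"
proof (cases "c = 0 \<and> b = 0")
  case False
  then obtain d c' b' where d: "d \<noteq> 0" "c = d * c'" "b = d * b'" "comaximal c' b'"
    using poly_bezout_cofactors by metis
  have "d\<^sup>2 * c'\<^sup>2 dvd d\<^sup>2 * (b'\<^sup>2 * D)"
    using assms(2) d by (simp add: power_mult_distrib mult.assoc)
  then have "c'\<^sup>2 dvd b'\<^sup>2 * D" using d(1) by simp
  then have "c'\<^sup>2 dvd D" using comaximal_dvd_mult comaximal_power d(4) by blast
  then obtain e where e: "D = c'\<^sup>2 * e" by (auto elim: dvdE)
  have "c' dvd D" "c' dvd pderiv D"
    unfolding e by (auto simp: pderiv_mult power2_eq_square)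
  then have "c' dvd 1" using assms(1) unfolding comaximal_def by (metis dvd_add dvd_mult)
  then show ?thesis using d by (metis dvd_mult_cancel_left dvd_trans dvd_triv_left mult.right_neutral)
qed simp

lemma square_dvd_square:
  fixes b c :: "'a::field poly"
  shows "c\<^sup>2 dvd b\<^sup>2 \<Longrightarrow> c dvd b"
proof -
  \<comment> \<open>The polynomial 1 is squarefree, so the previous lemma applies with
    \<open>D = 1\<close>.\<close>
  have "1 * (1::'a poly) + 0 * pderiv 1 = 1" by simp
  then have "comaximal (1::'a poly) (pderiv 1)" unfolding comaximal_def by blast
  then show "c\<^sup>2 dvd b\<^sup>2 \<Longrightarrow> c dvd b" using square_dvd_square_times_squarefree[of 1 c b] by simp
qed

section \<open>Evaluation of polynomials along a field embedding\<close>

lemma field_embedding_to_ac: "field_embedding to_ac"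
  by unfold_locales simp_all

context field_embedding
begin

lemma emb_zero [simp]: "\<iota> 0 = 0"
  using emb_add[of 0 0] by (metis add.right_neutral add_left_cancel)

declare emb_one [simp]

lemma emb_uminus: "\<iota> (- a) = - \<iota> a"
  using emb_add[of a "- a"] by (simp add: eq_neg_iff_add_eq_0 add.commute)

lemma emb_diff: "\<iota> (a - b) = \<iota> a - \<iota> b"
  using emb_add[of a "- b"] by (simp add: emb_uminus)

lemma emb_eq_0_iff [simp]: "\<iota> a = 0 \<longleftrightarrow> a = 0"
  using emb_mult[of a "inverse a"] by (cases "a = 0") auto

lemma emb_power: "\<iota> (a ^ n) = \<iota> a ^ n"
  by (induction n) (simp_all add: emb_mult)

lemma emb_inverse: "\<iota> (inverse a) = inverse (\<iota> a)"
  using emb_mult[of a "inverse a"]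
  by (cases "a = 0") (auto simp: inverse_eq_divide eq_divide_eq mult.commute)

lemma emb_divide: "\<iota> (a / b) = \<iota> a / \<iota> b"
  by (simp add: divide_inverse emb_mult emb_inverse)

lemma emb_of_nat: "\<iota> (of_nat n) = of_nat n"
  by (induction n) (simp_all add: emb_add)

lemma emb_two: "\<iota> 2 = 2"
  using emb_of_nat[of 2] by simp

lemma eval_over_0 [simp]: "eval_over \<iota> 0 x = 0"
  by (simp add: eval_over_def)

lemma eval_over_pCons [simp]: "eval_over \<iota> (pCons a p) x = \<iota> a + x * eval_over \<iota> p x"
  by (cases "p = 0 \<and> a = 0") (auto simp: eval_over_def map_poly_pCons)

lemma eval_over_1 [simp]: "eval_over \<iota> 1 x = 1"
  by (simp add: one_pCons)

lemma eval_over_add: "eval_over \<iota> (p + q) x = eval_over \<iota> p x + eval_over \<iota> q x"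
  by (induction p q rule: poly_induct2) (simp_all add: emb_add algebra_simps)

lemma eval_over_smult: "eval_over \<iota> (Polynomial.smult a p) x = \<iota> a * eval_over \<iota> p x"
  by (induction p) (simp_all add: emb_mult algebra_simps)

lemma eval_over_uminus: "eval_over \<iota> (- p) x = - eval_over \<iota> p x"
  using eval_over_smult[of "-1" p x] by (simp add: emb_uminus)

lemma eval_over_diff: "eval_over \<iota> (p - q) x = eval_over \<iota> p x - eval_over \<iota> q x"
  using eval_over_add[of p "- q" x] by (simp add: eval_over_uminus)

lemma eval_over_mult: "eval_over \<iota> (p * q) x = eval_over \<iota> p x * eval_over \<iota> q x"
  by (induction p) (simp_all add: eval_over_add eval_over_smult algebra_simps)

lemma eval_over_power: "eval_over \<iota> (p ^ n) x = eval_over \<iota> p x ^ n"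
  by (induction n) (simp_all add: eval_over_mult)

lemma eval_over_of_nat: "eval_over \<iota> (of_nat n) x = of_nat n"
  by (induction n) (simp_all add: eval_over_add)

lemma eval_over_numeral: "eval_over \<iota> (numeral n) x = numeral n"
  using eval_over_of_nat[of "numeral n" x] by simp

lemma eval_over_sum: "eval_over \<iota> (sum f A) x = (\<Sum>i\<in>A. eval_over \<iota> (f i) x)"
  by (induction A rule: infinite_finite_induct) (simp_all add: eval_over_add)

lemma eval_over_monom: "eval_over \<iota> (Polynomial.monom a n) x = \<iota> a * x ^ n"
  by (induction n) (simp_all add: monom_0 monom_Suc)

lemma eval_over_altdef:
  assumes "Polynomial.degree p \<le> n"
  shows "eval_over \<iota> p x = (\<Sum>i\<le>n. \<iota> (Polynomial.coeff p i) * x ^ i)"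
proof -
  have "eval_over \<iota> p x = eval_over \<iota> (\<Sum>i\<le>n. Polynomial.monom (Polynomial.coeff p i) i) x"
    using poly_as_sum_of_monoms'[OF assms] by simp
  then show ?thesis by (simp add: eval_over_sum eval_over_monom)
qed

lemmas eval_over_hom = eval_over_add eval_over_diff eval_over_uminus eval_over_mult eval_over_power
  eval_over_smult eval_over_numeral eval_over_of_nat

end

text \<open>A nonconstant common divisor of \<open>D\<close> and its derivative has a root in the
  algebraic closure, and this would be a double root of \<open>D\<close>.\<close>

lemma separable_poly_comaximal:
  fixes D :: "'k::field poly"
  assumes "separable_poly D"
  shows "comaximal D (pderiv D)"
proof -
  interpret ac: field_embedding "to_ac :: 'k \<Rightarrow> 'k alg_closure" by (rule field_embedding_to_ac)
  obtain d a b where d: "d = a * D + b * pderiv D" "d dvd D" "d dvd pderiv D" by (rule poly_bezout)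
  let ?m = "map_poly to_ac :: 'k poly \<Rightarrow> 'k alg_closure poly"
  have sq: "rsquarefree (?m D)" using assms by (simp add: separable_poly_def)
  have "\<not> Polynomial.degree d > 0"
  proof
    assume "Polynomial.degree d > 0"
    then have "Polynomial.degree (?m d) > 0" by (simp add: degree_map_poly)
    then obtain z where "poly (?m d) z = 0" using alg_closed_imp_poly_has_root by blast
    then have "eval_over to_ac d z = 0" by (simp add: eval_over_def)
    then have z: "eval_over to_ac D z = 0" "eval_over to_ac (pderiv D) z = 0"
      using d(2,3) by (auto elim!: dvdE simp: ac.eval_over_mult)
    have pd: "?m (pderiv D) = pderiv (?m D)"
      by (rule poly_eqI) (simp add: coeff_map_poly coeff_pderiv)
    have z': "poly (?m D) z = 0" "poly (pderiv (?m D)) z = 0"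
      using z by (simp_all add: eval_over_def pd)
    have "?m D \<noteq> 0" using sq by (auto simp: rsquarefree_def)
    moreover from this have "Polynomial.order z (?m D) = 1"
      using rsquarefree_root_order sq z'(1) by blast
    ultimately have nd: "\<not> [:-z, 1:]\<^sup>2 dvd ?m D" using order_divides[of z 2 "?m D"] by simp
    \<comment> \<open>One factor is split off; the product rule at \<open>z\<close> then yields a
      second one.\<close>
    obtain q where q: "?m D = [:-z, 1:] * q" using z'(1) by (auto simp: poly_eq_0_iff_dvd elim: dvdE)
    have "poly q z = 0" using z'(2) unfolding q pderiv_mult by (simp add: pderiv_pCons)
    then obtain r where "q = [:-z, 1:] * r" by (auto simp: poly_eq_0_iff_dvd elim: dvdE)
    with q have "[:-z, 1:]\<^sup>2 dvd ?m D" by (metis dvd_triv_left mult.assoc power2_eq_square)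
    with nd show False by blast
  qed
  moreover have "D \<noteq> 0" using sq by (auto simp: rsquarefree_def)
  then have "d \<noteq> 0" using d(2) by auto
  ultimately have "d dvd 1" by (simp add: is_unit_iff_degree)
  then obtain e where "1 = d * e" by (auto elim: dvdE)
  then have "(e * a) * D + (e * b) * pderiv D = 1" using d(1) by (simp add: algebra_simps)
  then show ?thesis unfolding comaximal_def by blast
qed

section \<open>Homogenization and reciprocal polynomials\<close>

text \<open>When n is at least the degree of P, this is q^n P(p/q) without denominators; a larger n
  only adds factors q.\<close>

definition homogenize :: "nat \<Rightarrow> 'a::comm_ring_1 poly \<Rightarrow> 'a poly \<Rightarrow> 'a poly \<Rightarrow> 'a poly" where
  "homogenize n P p q = (\<Sum>i\<le>n. Polynomial.smult (Polynomial.coeff P i) (p ^ i * q ^ (n - i)))"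

text \<open>For deg P \<le> n this is T^n P(1/T). With n explicit, the degrees 2g + 1 and 2g + 2 can
  share n = 2g + 2; in odd degree the reversed polynomial vanishes at 0.\<close>

definition reciprocal :: "nat \<Rightarrow> 'a::comm_ring_1 poly \<Rightarrow> 'a poly" where
  "reciprocal n P = homogenize n P 1 [:0, 1:]"

lemma coeff_reciprocal:
  "Polynomial.coeff (reciprocal n P) j = (if j \<le> n then Polynomial.coeff P (n - j) else 0)"
proof -
  have "Polynomial.coeff (reciprocal n P) j = (\<Sum>i\<le>n. if i = n - j \<and> j \<le> n then Polynomial.coeff P i else 0)"
    unfolding reciprocal_def homogenize_def coeff_sum
    by (rule sum.cong) (auto simp: monom_altdef[symmetric])
  also have "\<dots> = (if j \<le> n then Polynomial.coeff P (n - j) else 0)"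
    by (cases "j \<le> n") simp_all
  finally show ?thesis .
qed

lemma degree_reciprocal_le: "Polynomial.degree (reciprocal n P) \<le> n"
  by (rule degree_le) (simp add: coeff_reciprocal)

text \<open>This is the product and chain rule for T^n P(1/T), multiplied by T.\<close>

lemma reciprocal_pderiv:
  assumes "n > 0"
  shows "of_nat n * reciprocal n P - [:0, 1:] * pderiv (reciprocal n P) = reciprocal (n - 1) (pderiv P)"
proof (rule poly_eqI)
  fix j
  show "Polynomial.coeff (of_nat n * reciprocal n P - [:0, 1:] * pderiv (reciprocal n P)) j =
    Polynomial.coeff (reciprocal (n - 1) (pderiv P)) j"
  proof (cases j)
    case 0
    then show ?thesis using assms by (simp add: coeff_reciprocal coeff_pderiv of_nat_poly)
  next
    case (Suc i)
    show ?thesis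
    proof (cases "Suc i \<le> n - 1")
      case True
      then have eq: "Suc (n - 1 - Suc i) = n - Suc i" "Suc i \<le> n" by simp_all
      have "(of_nat n :: 'a) = of_nat (Suc i) + of_nat (n - Suc i)"
        using True by (simp flip: of_nat_add)
      with True eq show ?thesis unfolding Suc
        by (simp add: coeff_reciprocal coeff_pderiv of_nat_poly Suc_diff_Suc algebra_simps)
    next
      case False
      \<comment> \<open>At index n the two terms on the left cancel; beyond n everything is
        0.\<close>
      with assms have "Suc i = n \<or> Suc i > n" by auto
      then show ?thesis unfolding Suc
        by (auto simp: coeff_reciprocal coeff_pderiv of_nat_poly algebra_simps)
    qed
  qed
qed

lemma comaximal_X:
  fixes P :: "'a::field poly"
  assumes "Polynomial.coeff P 0 \<noteq> 0"
  shows "comaximal [:0, 1:] P"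
proof -
  obtain c r where P: "P = pCons c r" by (cases P)
  then have c: "c \<noteq> 0" using assms by simp
  have "(- Polynomial.smult (1/c) r) * [:0, 1:] + [:1/c:] * P = 1"
    using c by (simp add: P one_pCons)
  then show ?thesis unfolding comaximal_def by blast
qed

lemma comaximal_of_ideal_member:
  assumes "comaximal r p" "r = a * p + b * q"
  shows "comaximal p q"
proof -
  obtain e f where "e * r + f * p = 1" using assms(1) unfolding comaximal_def by blast
  then have "(e * a + f) * p + (e * b) * q = 1" unfolding assms(2) by (simp add: algebra_simps)
  then show ?thesis unfolding comaximal_def by blast
qed

context field_embedding
begin

lemma eval_over_homogenize:
  assumes "Polynomial.degree P \<le> n" "eval_over \<iota> q x \<noteq> 0"
  shows "eval_over \<iota> (homogenize n P p q) x
       = eval_over \<iota> q x ^ n * eval_over \<iota> P (eval_over \<iota> p x / eval_over \<iota> q x)"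
  unfolding homogenize_def eval_over_altdef[OF assms(1)] sum_distrib_left eval_over_sum
proof (rule sum.cong)
  fix i assume "i \<in> {..n}"
  then have "n = i + (n - i)" by simp
  then have "eval_over \<iota> q x ^ n = eval_over \<iota> q x ^ i * eval_over \<iota> q x ^ (n - i)"
    by (metis power_add)
  then show "eval_over \<iota> (Polynomial.smult (Polynomial.coeff P i) (p ^ i * q ^ (n - i))) x =
    eval_over \<iota> q x ^ n * (\<iota> (Polynomial.coeff P i) * (eval_over \<iota> p x / eval_over \<iota> q x) ^ i)"
    using assms(2) by (simp add: eval_over_hom power_divide)
qed simp

lemma eval_over_reciprocal:
  assumes "Polynomial.degree P \<le> n" "x \<noteq> 0"
  shows "eval_over \<iota> (reciprocal n P) x = x ^ n * eval_over \<iota> P (1 / x)"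
  unfolding reciprocal_def using eval_over_homogenize[OF assms(1), of "[:0, 1:]" x 1] assms(2)
  by simp

lemma transcendental_over_nonzero: "transcendental_over \<iota> t \<Longrightarrow> t \<noteq> 0"
  unfolding transcendental_over_def by (auto dest: spec[of _ "[:0, 1:]"])

lemma transcendental_over_eval_eq_iff:
  "transcendental_over \<iota> t \<Longrightarrow> eval_over \<iota> p t = eval_over \<iota> q t \<longleftrightarrow> p = q"
  unfolding transcendental_over_def
  by (metis eq_iff_diff_eq_0 eval_over_diff)

text \<open>The Bezout identity for E, taken at 1/T and cleared of denominators, puts a power of T
  into the ideal of the reversed polynomial and its derivative. Only a double zero at 0 remains to
  be excluded, which is what n \<le> deg E + 1 does.\<close>

lemma comaximal_reciprocal:
  fixes E :: "'k poly"
  assumes t: "transcendental_over \<iota> t"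
    and E: "comaximal E (pderiv E)"
    and deg: "Polynomial.degree E \<le> n" "n \<le> Suc (Polynomial.degree E)" "n > 0"
  shows "comaximal (reciprocal n E) (pderiv (reciprocal n E))"
proof -
  let ?E = "reciprocal n E" and ?X = "[:0, 1:] :: 'k poly"
  obtain M N where MN: "M * E + N * pderiv E = 1" using E unfolding comaximal_def by blast
  define m where "m = Polynomial.degree M + Polynomial.degree N"
  have t0: "t \<noteq> 0" by (rule transcendental_over_nonzero[OF t])
  have dE': "Polynomial.degree (pderiv E) \<le> n - 1"
    using deg(1) by (intro degree_le) (simp add: coeff_pderiv coeff_eq_0)
  have tn: "t * t ^ (n - 1) = t ^ n" using deg(3) by (metis Suc_pred' power_Suc)
  \<comment> \<open>The transcendental \<open>t\<close> stands in for an indeterminate: an identity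
    checked at \<open>t\<close> is read back as one of polynomials.\<close>
  have "eval_over \<iota> (reciprocal m M * ?E + ?X * reciprocal m N * reciprocal (n - 1) (pderiv E)) t
     = t ^ m * t ^ n * eval_over \<iota> M (1/t) * eval_over \<iota> E (1/t)
       + t ^ m * (t * t ^ (n - 1)) * eval_over \<iota> N (1/t) * eval_over \<iota> (pderiv E) (1/t)"
    using t0 deg(1) dE' by (simp add: eval_over_hom eval_over_reciprocal m_def algebra_simps)
  also have "\<dots> = t ^ m * t ^ n * eval_over \<iota> (M * E + N * pderiv E) (1/t)"
    unfolding tn by (simp add: eval_over_hom algebra_simps)
  also have "\<dots> = eval_over \<iota> (?X ^ (m + n)) t"
    by (simp add: MN eval_over_hom power_add)
  finally have "reciprocal m M * ?E + ?X * reciprocal m N * reciprocal (n - 1) (pderiv E) = ?X ^ (m + n)"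
    using transcendental_over_eval_eq_iff[OF t] by blast
  then have "?X ^ (m + n) = (reciprocal m M + ?X * reciprocal m N * of_nat n) * ?E
      + (- (?X * reciprocal m N * ?X)) * pderiv ?E"
    unfolding reciprocal_pderiv[OF deg(3), symmetric] by (simp only: algebra_simps mult_minus_left mult_minus_right) simp
  then obtain a b where ab: "?X ^ (m + n) = a * ?E + b * pderiv ?E" by blast
  show ?thesis
  proof (cases "Polynomial.coeff ?E 0 = 0")
    case False
    then have "comaximal (?X ^ (m + n)) ?E"
      using comaximal_power[OF comaximal_X, of _ _ 1] by simp
    then show ?thesis using comaximal_of_ideal_member ab by blast
  next
    case True
    \<comment> \<open>The constant coefficient of \<open>?E\<close> is the coefficient of E at n, so
      its vanishing leaves n = deg E + 1. The linear coefficient of \<open>?E\<close> is then the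
      leading coefficient of E.\<close>
    then have "n \<noteq> Polynomial.degree E"
      using E by (auto simp: coeff_reciprocal comaximal_def)
    have "E \<noteq> 0" using E by (auto simp: comaximal_def)
    with \<open>n \<noteq> Polynomial.degree E\<close> True have "n = Suc (Polynomial.degree E)" using deg by auto
    then have "Polynomial.coeff (pderiv ?E) 0 \<noteq> 0"
      using \<open>E \<noteq> 0\<close> by (simp add: coeff_pderiv coeff_reciprocal)
    then have "comaximal (?X ^ (m + n)) (pderiv ?E)"
      using comaximal_power[OF comaximal_X, of _ _ 1] by simp
    moreover have "?X ^ (m + n) = b * pderiv ?E + a * ?E" using ab by (simp add: add.commute)
    ultimately show ?thesis
      using comaximal_of_ideal_member comaximal_commute by blast
  qed
qed

end

section \<open>Derivations and the order \<open>k[t] + k[t] u\<close>\<close>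

text \<open>Change of chart to infinity: (x, y) becomes (1/x, y/x^(g+1)) and E is reversed.\<close>

lemma (in field_embedding) reciprocal_square:
  assumes "Polynomial.degree E \<le> 2 * g + 2" "x \<noteq> 0" "y\<^sup>2 = eval_over \<iota> E x"
  shows "(y / x ^ (g + 1))\<^sup>2 = eval_over \<iota> (reciprocal (2 * g + 2) E) (1 / x)"
proof -
  have "(x ^ (g + 1))\<^sup>2 = x ^ (2 * g + 2)"
    by (simp add: power2_eq_square power_add mult_2)
  then show ?thesis
    using eval_over_reciprocal[OF assms(1), of "1 / x"] assms(2,3) by (simp add: power_divide)
qed

locale derivation_over = field_embedding \<iota> for \<iota> :: "'k::field \<Rightarrow> 'f::field" +
  fixes d :: "'f \<Rightarrow> 'f"
  assumes d_emb: "d (\<iota> c) = 0"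
    and d_add: "d (f + h) = d f + d h"
    and d_mult: "d (f * h) = d f * h + f * d h"
begin

lemma d_0: "d 0 = 0"
  using d_emb[of 0] by simp

lemma d_1: "d 1 = 0"
  using d_emb[of 1] by simp

lemma d_uminus: "d (- f) = - d f"
  using d_add[of f "- f"] by (simp add: d_0 eq_neg_iff_add_eq_0 add.commute)

lemma d_diff: "d (f - h) = d f - d h"
  using d_add[of f "- h"] by (simp add: d_uminus)

lemma d_divide:
  assumes "h \<noteq> 0"
  shows "d (f / h) = (d f * h - f * d h) / h\<^sup>2"
proof -
  have "d f = d (f / h) * h + f / h * d h" using d_mult[of "f / h" h] assms by simp
  then show ?thesis using assms by (simp add: field_simps power2_eq_square)
qed

lemma d_inverse: "d (inverse f) = - d f / f\<^sup>2"
  using d_divide[of f 1] by (cases "f = 0") (simp_all add: d_0 d_1 inverse_eq_divide)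

lemma d_power_Suc: "d (f ^ Suc n) = of_nat (Suc n) * f ^ n * d f"
  by (induction n) (simp_all add: d_mult algebra_simps)

lemma d_eval_over: "d (eval_over \<iota> p f) = eval_over \<iota> (pderiv p) f * d f"
  by (induction p) (simp_all add: d_0 d_add d_mult d_emb pderiv_pCons eval_over_hom algebra_simps)

text \<open>The constants of a derivation form a subfield containing k.\<close>

lemma d_eq_0_of_generators:
  assumes "field_adjoin \<iota> A = UNIV" "\<And>a. a \<in> A \<Longrightarrow> d a = 0"
  shows "d f = 0"
proof -
  have "f \<in> subfield_set hull (range \<iota> \<union> A)" using assms(1) by (simp add: field_adjoin_def)
  then show ?thesis
  proof (rule hull_induct)
    show "subfield_set {f. d f = 0}"
      by (auto simp: subfield_set_def d_1 d_diff d_mult d_inverse)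
  qed (use assms(2) d_emb in auto)
qed

end

section \<open>The affine ring of a hyperelliptic curve\<close>

text \<open>\<open>independent\<close> and \<open>generated\<close> make 1, u a basis of F over
  k(t). With \<open>d t = u\<close>, the value \<open>d f\<close> is the quotient of the
  differentials df and dt/u. The degree of \<open>D\<close> is left free so that the chart at
  infinity is an instance too.\<close>

locale quadratic_chart = derivation_over \<iota> d
  for \<iota> :: "'k::field \<Rightarrow> 'f::field" and d +
  fixes D :: "'k poly" and t u :: 'f
  assumes two_nonzero: "(2::'k) \<noteq> 0"
    and squarefree_D: "comaximal D (pderiv D)"
    and u_square: "u\<^sup>2 = eval_over \<iota> D t"
    and independent: "eval_over \<iota> a t + eval_over \<iota> b t * u = 0 \<Longrightarrow> a = 0 \<and> b = 0"
    and generated: "\<exists>a b c. c \<noteq> 0 \<and> f = (eval_over \<iota> a t + eval_over \<iota> b t * u) / eval_over \<iota> c t"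
    and d_t: "d t = u"
begin

abbreviation ev :: "'k poly \<Rightarrow> 'f" where "ev p \<equiv> eval_over \<iota> p t"

text \<open>As \<open>D\<close> is squarefree and 2 is invertible, this is the integral closure of
  k[t] in F.\<close>

definition R :: "'f set" where "R = {ev a + ev b * u | a b. True}"

lemma RI: "f = ev a + ev b * u \<Longrightarrow> f \<in> R"
  unfolding R_def by blast

lemma RE: assumes "f \<in> R" obtains a b where "f = ev a + ev b * u"
  using assms unfolding R_def by blast

lemma coords_eq: "ev a + ev b * u = ev a' + ev b' * u \<longleftrightarrow> a = a' \<and> b = b'"
  using independent[of "a - a'" "b - b'"] by (auto simp: eval_over_hom algebra_simps)

lemma t_transcendental: "transcendental_over \<iota> t"
  unfolding transcendental_over_def using independent[of _ 0] by auto

lemma ev_eq_iff: "ev a = ev b \<longleftrightarrow> a = b"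
  by (rule transcendental_over_eval_eq_iff[OF t_transcendental])

lemma ev_eq_0_iff: "ev a = 0 \<longleftrightarrow> a = 0"
  using ev_eq_iff[of a 0] by simp

lemma u_nonzero: "u \<noteq> 0"
  using independent[of 0 1] by auto

lemma ev_in_R: "ev p \<in> R"
  by (rule RI[of _ p 0]) simp

lemma u_in_R: "u \<in> R"
  by (rule RI[of _ 0 1]) simp

lemma emb_in_R: "\<iota> c \<in> R"
  using ev_in_R[of "[:c:]"] by simp

lemma zero_in_R: "0 \<in> R" and one_in_R: "1 \<in> R"
  using ev_in_R[of 0] ev_in_R[of 1] by simp_all

lemma R_add: assumes "f \<in> R" "h \<in> R" shows "f + h \<in> R"
proof -
  obtain a b a' b' where "f = ev a + ev b * u" "h = ev a' + ev b' * u" using assms RE by metis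
  then show ?thesis by (intro RI[of _ "a + a'" "b + b'"]) (simp add: eval_over_hom algebra_simps)
qed

lemma R_mult: assumes "f \<in> R" "h \<in> R" shows "f * h \<in> R"
proof -
  obtain a b a' b' where "f = ev a + ev b * u" "h = ev a' + ev b' * u" using assms RE by metis
  then show ?thesis
    by (intro RI[of _ "a * a' + b * b' * D" "a * b' + a' * b"])
      (simp add: eval_over_hom u_square[symmetric] power2_eq_square algebra_simps)
qed

lemma R_uminus: "f \<in> R \<Longrightarrow> - f \<in> R"
  using R_mult[OF emb_in_R[of "-1"], of f] by (simp add: emb_uminus)

lemma R_diff: "f \<in> R \<Longrightarrow> h \<in> R \<Longrightarrow> f - h \<in> R"
  using R_add[of f "- h"] R_uminus[of h] by simp

lemma R_power: "f \<in> R \<Longrightarrow> f ^ n \<in> R"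
  by (induction n) (simp_all add: one_in_R R_mult)

lemma R_of_nat: "of_nat n \<in> R"
  using emb_in_R[of "of_nat n"] by (simp add: emb_of_nat)

lemma R_sum: "(\<And>i. i \<in> A \<Longrightarrow> f i \<in> R) \<Longrightarrow> sum f A \<in> R"
  by (induction A rule: infinite_finite_induct) (simp_all add: zero_in_R R_add)

lemma two_nonzero_in_extension: "(2::'f) \<noteq> 0"
  using two_nonzero emb_two emb_eq_0_iff by metis

lemma d_u: "d u = ev (pderiv D) / 2"
proof -
  have "2 * u * d u = ev (pderiv D) * u"
    using arg_cong[OF u_square, of d] by (simp add: power2_eq_square d_mult d_eval_over d_t algebra_simps)
  then show ?thesis using u_nonzero two_nonzero_in_extension by (simp add: field_simps)
qed

text \<open>This is the purpose of the normalisation \<open>d t = u\<close>: it makes d u = D'(t)/2,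
  whereas d t = 1 would put u into the denominator.\<close>

lemma d_in_R: assumes "f \<in> R" shows "d f \<in> R"
proof -
  obtain a b where f: "f = ev a + ev b * u" using assms RE by metis
  have "d u = \<iota> (1 / 2) * ev (pderiv D)" by (simp add: d_u emb_divide emb_two)
  then have "d u \<in> R" using R_mult emb_in_R ev_in_R by metis
  then show ?thesis
    unfolding f by (simp add: d_add d_mult d_eval_over d_t R_add R_mult ev_in_R u_in_R)
qed

lemma dvd_double_iff: "c dvd 2 * a \<longleftrightarrow> c dvd a" for a c :: "'k poly"
proof -
  have "2 * a = Polynomial.smult 2 a" by (simp add: numeral_poly)
  then show ?thesis using two_nonzero by (simp add: dvd_smult_iff)
qed

text \<open>The hypotheses say that trace and norm of the quotient lie in k[t], that is, that it is
  integral over k[t].\<close>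

lemma quotient_in_R:
  assumes "c \<noteq> 0" "c dvd 2 * a" "c\<^sup>2 dvd a\<^sup>2 - b\<^sup>2 * D"
  shows "(ev a + ev b * u) / ev c \<in> R"
proof -
  have ca: "c dvd a" using assms(2) dvd_double_iff by blast
  then have "c\<^sup>2 dvd a\<^sup>2" by (rule dvd_power_same)
  then have "c\<^sup>2 dvd b\<^sup>2 * D" using assms(3) by (metis dvd_diff_right_iff)
  then have "c dvd b" using square_dvd_square_times_squarefree squarefree_D by blast
  then obtain a' b' where ab: "a = c * a'" "b = c * b'" using ca by (meson dvdE)
  show ?thesis
    by (rule RI[of _ a' b']) (use assms(1) in \<open>simp add: ab eval_over_hom field_simps ev_eq_0_iff\<close>)
qed

text \<open>Norms multiply, so the square of the norm of f is a polynomial, and hence so is the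
  norm. Adding it to the first coordinate of f^2 gives that c^2 divides 2a^2, which makes the trace
  a polynomial too.\<close>

lemma R_of_square: assumes "f\<^sup>2 \<in> R" shows "f \<in> R"
proof -
  obtain a b c where c: "c \<noteq> 0" and f: "f = (ev a + ev b * u) / ev c" using generated by blast
  obtain r s where rs: "f\<^sup>2 = ev r + ev s * u" using assms RE by metis
  have "(ev a + ev b * u)\<^sup>2 = ev c ^ 2 * (ev r + ev s * u)"
    unfolding rs[symmetric] f using c by (simp add: power_divide ev_eq_0_iff)
  then have "ev (a\<^sup>2 + b\<^sup>2 * D) + ev (2 * a * b) * u = ev (c\<^sup>2 * r) + ev (c\<^sup>2 * s) * u"
    by (simp add: eval_over_hom u_square[symmetric] power2_eq_square algebra_simps)
  then have e: "a\<^sup>2 + b\<^sup>2 * D = c\<^sup>2 * r" "2 * a * b = c\<^sup>2 * s"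
    using coords_eq by blast+
  \<comment> \<open>The left side is the squared norm of the numerator, the right side the norm of
    its square.\<close>
  have "(a\<^sup>2 - b\<^sup>2 * D)\<^sup>2 = (a\<^sup>2 + b\<^sup>2 * D)\<^sup>2 - (2 * a * b)\<^sup>2 * D"
    by (simp add: power2_eq_square algebra_simps)
  also have "\<dots> = (c\<^sup>2)\<^sup>2 * (r\<^sup>2 - s\<^sup>2 * D)"
    unfolding e by (simp add: power2_eq_square algebra_simps)
  finally have "(c\<^sup>2)\<^sup>2 dvd (a\<^sup>2 - b\<^sup>2 * D)\<^sup>2" by (rule dvdI)
  then have n: "c\<^sup>2 dvd a\<^sup>2 - b\<^sup>2 * D" by (rule square_dvd_square)
  have "2 * a\<^sup>2 = (a\<^sup>2 + b\<^sup>2 * D) + (a\<^sup>2 - b\<^sup>2 * D)" by simp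
  moreover have "c\<^sup>2 dvd a\<^sup>2 + b\<^sup>2 * D" unfolding e by simp
  ultimately have "c\<^sup>2 dvd 2 * a\<^sup>2" using n by (metis dvd_add)
  then have "c dvd a" using dvd_double_iff square_dvd_square by blast
  then show ?thesis unfolding f by (intro quotient_in_R c n) simp
qed

text \<open>
  For \<open>\<alpha> = a + b u\<close> with norm \<open>n\<close>, let \<open>e\<close> be the greatest common divisor of the norms \<open>n\<close>, \<open>c\<^sup>2\<close> and the trace
  \<open>2 a c\<close> of \<open>\<alpha> c\<close>. Since \<open>R\<close> is integrally closed, \<open>e\<close> divides the product of the ideal \<open>(\<alpha>, c)\<close> with its conjugate;
  the two fractions arise from \<open>\<alpha> / c\<close> by scaling with the conjugate of \<open>\<alpha>\<close> over \<open>e\<close> and with \<open>c / e\<close>.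
\<close>

lemma comaximal_fractions:
  assumes "f \<noteq> 0"
  obtains \<alpha>1 \<beta>1 \<alpha>2 \<beta>2 P Q S where
    "\<alpha>1 \<in> R" "\<beta>1 \<in> R" "\<alpha>2 \<in> R" "\<beta>2 \<in> R" "P \<in> R" "Q \<in> R" "S \<in> R"
    "\<beta>1 \<noteq> 0" "\<beta>2 \<noteq> 0" "f = \<alpha>1 / \<beta>1" "f = \<alpha>2 / \<beta>2"
    "P * \<alpha>1 + Q * \<beta>2 + S * (\<alpha>2 + \<beta>1) = 1"
proof -
  obtain a b c where c: "c \<noteq> 0" and f: "f = (ev a + ev b * u) / ev c" using generated by blast
  define n where "n = a\<^sup>2 - b\<^sup>2 * D"
  obtain e' p q where e': "e' = p * c\<^sup>2 + q * (2 * a * c)" "e' dvd c\<^sup>2" "e' dvd 2 * a * c"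
    by (rule poly_bezout)
  obtain e r s where e: "e = r * n + s * e'" "e dvd n" "e dvd e'" by (rule poly_bezout)
  have ed: "e dvd c\<^sup>2" "e dvd 2 * (a * c)" using e(3) e'(2,3) dvd_trans by (metis mult.assoc)+
  have e0: "e \<noteq> 0" using ed(1) c by auto
  \<comment> \<open>This is the norm of \<alpha> c, equal to n c^2, and \<open>e\<close> divides
    both factors; so \<alpha> c and its conjugate can be divided by \<open>e\<close> within
    \<open>R\<close>.\<close>
  have en: "e\<^sup>2 dvd (a * c)\<^sup>2 - (b * c)\<^sup>2 * D"
  proof -
    have "e * e dvd n * c\<^sup>2" using e(2) ed(1) by (rule mult_dvd_mono)
    then show ?thesis by (simp add: n_def power2_eq_square algebra_simps)
  qed
  have nz: "ev c \<noteq> 0" "ev e \<noteq> 0" "ev a + ev b * u \<noteq> 0" using c e0 assms f by (auto simp: ev_eq_0_iff)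
  have "ev a + ev (- b) * u \<noteq> 0"
    using nz(3) independent[of a "- b"] by auto
  then have nz': "ev a - ev b * u \<noteq> 0" by (simp add: eval_over_uminus)
  have N: "ev n = (ev a + ev b * u) * (ev a - ev b * u)"
    by (simp add: n_def eval_over_hom u_square[symmetric] power2_eq_square algebra_simps)
  show ?thesis
  \<comment> \<open>The fractions are n/e over the conjugate of \<alpha> c / e, and \<alpha> c / e
    over c^2/e; the last three witnesses come from the two Bezout identities.\<close>
  proof (rule that[of "ev n / ev e" "(ev (a * c) + ev (- b * c) * u) / ev e"
        "(ev (a * c) + ev (b * c) * u) / ev e" "ev (c\<^sup>2) / ev e" "ev r" "ev (s * p)" "ev (s * q)"])
    show "ev n / ev e \<in> R" "ev (c\<^sup>2) / ev e \<in> R"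
      using e(2) ed(1) e0 by (auto elim!: dvdE simp: eval_over_mult ev_eq_0_iff ev_in_R)
    show "(ev (a * c) + ev (- b * c) * u) / ev e \<in> R" "(ev (a * c) + ev (b * c) * u) / ev e \<in> R"
      using e0 ed(2) en by (auto intro!: quotient_in_R)
    have conj: "ev (a * c) + ev (- b * c) * u = (ev a - ev b * u) * ev c"
      by (simp add: eval_over_hom algebra_simps)
    show "(ev (a * c) + ev (- b * c) * u) / ev e \<noteq> 0"
      unfolding conj using nz nz' by simp
    show "ev (c\<^sup>2) / ev e \<noteq> 0" using nz by (simp add: eval_over_power)
    show "f = (ev n / ev e) / ((ev (a * c) + ev (- b * c) * u) / ev e)"
      unfolding conj N f using nz nz' by simp
    show "f = ((ev (a * c) + ev (b * c) * u) / ev e) / (ev (c\<^sup>2) / ev e)"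
      unfolding f using nz by (simp add: eval_over_hom field_simps power2_eq_square)
    \<comment> \<open>The two elements in the last bracket are conjugate, so their sum is the trace
      2ac/e.\<close>
    have "ev r * (ev n / ev e) + ev (s * p) * (ev (c\<^sup>2) / ev e) +
      ev (s * q) * ((ev (a * c) + ev (b * c) * u) / ev e + (ev (a * c) + ev (- b * c) * u) / ev e)
      = ev (r * n + s * (p * c\<^sup>2 + q * (2 * a * c))) / ev e"
      by (simp add: eval_over_hom add_divide_distrib[symmetric] algebra_simps)
    also have "\<dots> = 1" unfolding e'(1)[symmetric] e(1)[symmetric] using nz by simp
    finally show "ev r * (ev n / ev e) + ev (s * p) * (ev (c\<^sup>2) / ev e) +
      ev (s * q) * ((ev (a * c) + ev (b * c) * u) / ev e + (ev (a * c) + ev (- b * c) * u) / ev e) = 1" .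
  qed (simp_all add: ev_in_R)
qed

section \<open>Localizations of the affine ring\<close>

text \<open>For nonzero \<open>r\<close> in \<open>R\<close> this is R[1/r]; for
  \<open>r = 0\<close> it is all of F. For fixed f, membership says that \<open>r\<close> lies in
  the radical of the ideal of denominators of f.\<close>

definition localization :: "'f \<Rightarrow> 'f set" where
  "localization r = {f. \<exists>n. r ^ n * f \<in> R}"

lemma localization_raise:
  assumes "r \<in> R" "r ^ n * f \<in> R" "n \<le> m"
  shows "r ^ m * f \<in> R"
proof -
  have "r ^ m * f = r ^ (m - n) * (r ^ n * f)"
    using assms(3) by (metis le_add_diff_inverse2 mult.assoc power_add)
  then show ?thesis using R_mult[OF R_power[OF assms(1)] assms(2)] by metis
qed

lemma R_subset_localization: "f \<in> R \<Longrightarrow> f \<in> localization r"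
  unfolding localization_def by (auto intro: exI[of _ 0])

lemma localization_add:
  assumes "r \<in> R" "f \<in> localization r" "h \<in> localization r"
  shows "f + h \<in> localization r"
proof -
  obtain m n where "r ^ m * f \<in> R" "r ^ n * h \<in> R" using assms unfolding localization_def by auto
  then have "r ^ (m + n) * f \<in> R" "r ^ (m + n) * h \<in> R"
    using localization_raise assms(1) by (meson le_add1 le_add2)+
  then have "r ^ (m + n) * (f + h) \<in> R" by (simp add: R_add distrib_left)
  then show ?thesis unfolding localization_def by blast
qed

lemma localization_mult:
  assumes "f \<in> localization r" "h \<in> localization r"
  shows "f * h \<in> localization r"
proof -
  obtain m n where "r ^ m * f \<in> R" "r ^ n * h \<in> R" using assms unfolding localization_def by auto
  then have "(r ^ m * f) * (r ^ n * h) \<in> R" by (rule R_mult)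
  then have "r ^ (m + n) * (f * h) \<in> R" by (simp add: power_add algebra_simps)
  then show ?thesis unfolding localization_def by blast
qed

lemma localization_power: "f \<in> localization r \<Longrightarrow> f ^ n \<in> localization r"
  by (induction n) (simp_all add: R_subset_localization one_in_R localization_mult)

lemma localization_eval_over:
  assumes "r \<in> R" "f \<in> localization r"
  shows "eval_over \<iota> p f \<in> localization r"
proof (induction p)
  case 0
  then show ?case by (simp add: R_subset_localization zero_in_R)
next
  case (pCons a p)
  then show ?case unfolding eval_over_pCons
    by (intro localization_add localization_mult assms R_subset_localization[OF emb_in_R])
qed

lemma localization_fraction:
  assumes "r \<noteq> 0" "s \<in> R"
  shows "s / r \<in> localization r"
  unfolding localization_def using assms by (auto intro!: exI[of _ 1])

lemma localization_d:
  assumes "r \<in> R" "f \<in> localization r"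
  shows "d f \<in> localization r"
proof -
  obtain n where "r ^ n * f \<in> R" using assms unfolding localization_def by auto
  then have n: "r ^ Suc n * f \<in> R" using localization_raise assms(1) le_SucI by blast
  \<comment> \<open>The factor \<open>r\<close> restores the power that is lost when r^(n+1) is
    differentiated.\<close>
  have "r * d (r ^ Suc n * f) = of_nat (Suc n) * d r * (r ^ Suc n * f) + r ^ Suc (Suc n) * d f"
    unfolding d_mult[of "r ^ Suc n" f] d_power_Suc by (simp add: algebra_simps)
  then have "r ^ Suc (Suc n) * d f = r * d (r ^ Suc n * f) - of_nat (Suc n) * d r * (r ^ Suc n * f)"
    by simp
  also have "\<dots> \<in> R" by (rule R_diff[OF R_mult[OF assms(1) d_in_R[OF n]]
        R_mult[OF R_mult[OF R_of_nat d_in_R[OF assms(1)]] n]])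
  finally show ?thesis unfolding localization_def by blast
qed

text \<open>Integral closedness passes to the localization: with an even power of \<open>r\<close>,
  the cleared element is again a square.\<close>

lemma localization_of_square:
  assumes "r \<in> R" "f\<^sup>2 \<in> localization r"
  shows "f \<in> localization r"
proof -
  obtain n where "r ^ n * f\<^sup>2 \<in> R" using assms unfolding localization_def by auto
  then have "r ^ (2 * n) * f\<^sup>2 \<in> R" by (rule localization_raise[OF assms(1)]) simp
  moreover have "(r ^ n * f)\<^sup>2 = r ^ (2 * n) * f\<^sup>2"
    by (simp add: power_mult_distrib power_mult[symmetric] mult.commute)
  ultimately have "r ^ n * f \<in> R" by (metis R_of_square)
  then show ?thesis unfolding localization_def by blast
qed

text \<open>The radical of the ideal of denominators of f is closed under sums: every term of (r +
  s)^(m+n) contains r^m or s^n.\<close>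

lemma localization_radical_add:
  assumes "r \<in> R" "s \<in> R" "f \<in> localization r" "f \<in> localization s"
  shows "f \<in> localization (r + s)"
proof -
  obtain m n where mn: "r ^ m * f \<in> R" "s ^ n * f \<in> R" using assms unfolding localization_def by auto
  have "(r + s) ^ (m + n) * f = (\<Sum>k\<le>m+n. of_nat ((m + n) choose k) * r ^ k * s ^ (m + n - k) * f)"
    by (simp add: binomial_ring sum_distrib_right)
  also have "\<dots> \<in> R"
  proof (rule R_sum)
    fix k assume "k \<in> {..m + n}"
    show "of_nat ((m + n) choose k) * r ^ k * s ^ (m + n - k) * f \<in> R"
    proof (cases "m \<le> k")
      case True
      have "of_nat ((m + n) choose k) * r ^ k * s ^ (m + n - k) * f
        = of_nat ((m + n) choose k) * s ^ (m + n - k) * (r ^ k * f)" by simp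
      also have "\<dots> \<in> R"
        by (rule R_mult[OF R_mult[OF R_of_nat R_power[OF assms(2)]]
              localization_raise[OF assms(1) mn(1) True]])
      finally show ?thesis .
    next
      case False
      have "of_nat ((m + n) choose k) * r ^ k * s ^ (m + n - k) * f
        = of_nat ((m + n) choose k) * r ^ k * (s ^ (m + n - k) * f)" by simp
      also have "\<dots> \<in> R"
        by (rule R_mult[OF R_mult[OF R_of_nat R_power[OF assms(1)]]
              localization_raise[OF assms(2) mn(2)]]) (use False in simp)
      finally show ?thesis .
    qed
  qed
  finally show ?thesis unfolding localization_def by blast
qed

lemma localization_radical_mult:
  assumes "r \<in> R" "c \<in> R" "f \<in> localization r"
  shows "f \<in> localization (c * r)"
proof -
  obtain n where "r ^ n * f \<in> R" using assms unfolding localization_def by auto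
  then have "(c * r) ^ n * f \<in> R"
    using R_mult[OF R_power[OF assms(2), of n]] by (simp add: power_mult_distrib mult.assoc)
  then show ?thesis unfolding localization_def by blast
qed

section \<open>Regularity of differentials\<close>

text \<open>Combining 2 y dy = E'(x) dx with M E + N E' = 1 rewrites dx/y without division by y,
  which covers the zeros of y. Moreover y lies in the localization because its square does.\<close>

lemma differential_in_localization:
  assumes r: "r \<in> R" "r \<noteq> 0" "s \<in> R" and x: "x = s / r"
    and E: "comaximal E (pderiv E)" and y: "y\<^sup>2 = eval_over \<iota> E x" "y \<noteq> 0"
  shows "x ^ i * d x / y \<in> localization r"
proof -
  obtain M N where "M * E + N * pderiv E = 1" using E unfolding comaximal_def by blast
  then have "eval_over \<iota> (M * E + N * pderiv E) x = 1" by simp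
  then have MN: "eval_over \<iota> M x * y\<^sup>2 + eval_over \<iota> N x * eval_over \<iota> (pderiv E) x = 1"
    by (simp add: eval_over_hom y(1))
  have dy: "2 * y * d y = eval_over \<iota> (pderiv E) x * d x"
    using arg_cong[OF y(1), of d] by (simp add: power2_eq_square d_mult d_eval_over algebra_simps)
  have "d x = (eval_over \<iota> M x * y\<^sup>2 + eval_over \<iota> N x * eval_over \<iota> (pderiv E) x) * d x"
    using MN by simp
  also have "\<dots> = eval_over \<iota> M x * y\<^sup>2 * d x + eval_over \<iota> N x * (2 * y * d y)"
    unfolding dy by (simp add: algebra_simps)
  finally have "d x / y = eval_over \<iota> M x * y * d x + of_nat 2 * eval_over \<iota> N x * d y"
    using y(2) by (simp add: field_simps power2_eq_square)
  then have eq: "x ^ i * d x / y = x ^ i * (eval_over \<iota> M x * y * d x + of_nat 2 * eval_over \<iota> N x * d y)"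
    by (metis times_divide_eq_right)
  have xl: "x \<in> localization r" unfolding x using r localization_fraction by blast
  have yl: "y \<in> localization r"
    by (rule localization_of_square[OF r(1)]) (simp add: y(1) localization_eval_over r xl)
  show ?thesis unfolding eq
    by (intro localization_mult localization_add localization_power localization_eval_over
        localization_d R_subset_localization R_of_nat r xl yl)
qed

text \<open>In the reversed chart the differential is -(1/x)^(g-1-i) d(1/x) / (y/x^(g+1)), and
  \<open>i < g\<close> keeps the exponent nonnegative. So it is regular wherever numerator or
  denominator of a fraction for x is nonzero, and for two suitable fractions these loci cover the
  affine curve.\<close>

lemma differential_in_R:
  assumes E: "comaximal E (pderiv E)"
    and deg: "Polynomial.degree E \<le> 2 * g + 2" "2 * g + 1 \<le> Polynomial.degree E"
    and y: "y\<^sup>2 = eval_over \<iota> E x" "y \<noteq> 0" and x0: "x \<noteq> 0" and i: "i < g"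
  shows "x ^ i * d x / y \<in> R"
proof -
  let ?h = "x ^ i * d x / y"
  have pole: "?h \<in> localization \<beta>" if "\<alpha> \<in> R" "\<beta> \<in> R" "\<beta> \<noteq> 0" "x = \<alpha> / \<beta>" for \<alpha> \<beta>
    using differential_in_localization[OF that(2,3,1,4) E y] .
  have zero: "?h \<in> localization \<alpha>" if "\<alpha> \<in> R" "\<beta> \<in> R" "\<beta> \<noteq> 0" "x = \<alpha> / \<beta>" for \<alpha> \<beta>
  proof -
    let ?E = "reciprocal (2 * g + 2) E" and ?x = "1 / x" and ?y = "y / x ^ (g + 1)"
    have a0: "\<alpha> \<noteq> 0" using that x0 by auto
    have "?y\<^sup>2 = eval_over \<iota> ?E ?x"
      by (rule reciprocal_square[OF deg(1) x0 y(1)])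
    moreover have "comaximal ?E (pderiv ?E)"
      using comaximal_reciprocal[OF t_transcendental E deg(1)] deg(2) by simp
    ultimately have "?x ^ (g - 1 - i) * d ?x / ?y \<in> localization \<alpha>"
      using differential_in_localization[of \<alpha> \<beta> ?x ?E ?y] that x0 y(2) a0 by simp
    moreover have "?x ^ (g - 1 - i) * d ?x / ?y = - ?h"
    proof -
      have "x ^ (g + 1) = x ^ (g - 1 - i) * x ^ i * x\<^sup>2"
        using i by (simp flip: power_add)
      then show ?thesis using x0 y(2) d_divide[OF x0, of 1]
        by (simp add: d_1 power_divide field_simps)
    qed
    ultimately have "\<iota> (-1) * (- ?h) \<in> localization \<alpha>"
      by (metis R_subset_localization emb_in_R localization_mult)
    then show ?thesis by (simp add: emb_uminus)
  qed
  obtain \<alpha>1 \<beta>1 \<alpha>2 \<beta>2 P Q S where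
    R: "\<alpha>1 \<in> R" "\<beta>1 \<in> R" "\<alpha>2 \<in> R" "\<beta>2 \<in> R" "P \<in> R" "Q \<in> R" "S \<in> R"
    and nz: "\<beta>1 \<noteq> 0" "\<beta>2 \<noteq> 0" "x = \<alpha>1 / \<beta>1" "x = \<alpha>2 / \<beta>2"
    and one: "P * \<alpha>1 + Q * \<beta>2 + S * (\<alpha>2 + \<beta>1) = 1"
    by (rule comaximal_fractions[OF x0])
  have "?h \<in> localization (P * \<alpha>1 + Q * \<beta>2 + S * (\<alpha>2 + \<beta>1))"
    by (intro localization_radical_add localization_radical_mult R_add R_mult R
        zero[OF R(1,2) nz(1,3)] zero[OF R(3,4) nz(2,4)] pole[OF R(1,2) nz(1,3)] pole[OF R(3,4) nz(2,4)])
  \<comment> \<open>The localization at 1 is \<open>R\<close> itself.\<close>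
  then show ?thesis unfolding one localization_def by auto
qed

end

section \<open>The two charts of the hyperelliptic curve\<close>

text \<open>A relation gives a^2 = b^2 D, so b \<noteq> 0 would make \<open>D\<close> a square e^2.
  Squarefreeness forces e to be a unit, against the positive degree.\<close>

lemma (in field_embedding) quadratic_independent:
  assumes t: "transcendental_over \<iota> t" and sq: "comaximal D (pderiv D)"
    and deg: "Polynomial.degree D > 0" and u: "u\<^sup>2 = eval_over \<iota> D t"
    and eq: "eval_over \<iota> a t + eval_over \<iota> b t * u = 0"
  shows "a = 0 \<and> b = 0"
proof -
  have "eval_over \<iota> a t = - (eval_over \<iota> b t * u)" using eq by (simp add: eq_neg_iff_add_eq_0)
  then have "eval_over \<iota> (a\<^sup>2) t = eval_over \<iota> (b\<^sup>2 * D) t"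
    by (simp add: eval_over_hom power_mult_distrib u)
  then have ab: "a\<^sup>2 = b\<^sup>2 * D" using transcendental_over_eval_eq_iff[OF t] by blast
  then have "b\<^sup>2 dvd a\<^sup>2" by (rule dvdI)
  then have "b dvd a" by (rule square_dvd_square)
  then obtain e where e: "a = b * e" by (rule dvdE)
  have "b = 0"
  proof (rule ccontr)
    assume "b \<noteq> 0"
    with ab have De: "D = e\<^sup>2" by (simp add: e power_mult_distrib)
    have "e\<^sup>2 dvd 1\<^sup>2 * D" by (simp add: De)
    then have "e dvd 1" by (rule square_dvd_square_times_squarefree[OF sq])
    then have "D dvd 1" unfolding De by (metis dvd_power_same power_one)
    then have "Polynomial.degree D = 0" using is_unit_iff_degree[of D] by fastforce
    with deg show False by simp
  qed
  with e show ?thesis by simp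
qed

text \<open>Fractions of this shape form a field: conjugate over norm provides inverses, and
  independence keeps the norm nonzero.\<close>

lemma (in field_embedding) quadratic_generated:
  fixes D :: "'k poly"
  assumes t: "transcendental_over \<iota> t" and sq: "comaximal D (pderiv D)"
    and deg: "Polynomial.degree D > 0" and u: "u\<^sup>2 = eval_over \<iota> D t"
    and gen: "field_adjoin \<iota> {t, u} = UNIV"
  shows "\<exists>a b c. c \<noteq> 0 \<and> f = (eval_over \<iota> a t + eval_over \<iota> b t * u) / eval_over \<iota> c t"
    (is "?P f")
proof -
  have ev0: "eval_over \<iota> c t = 0 \<longleftrightarrow> c = 0" for c
    using transcendental_over_eval_eq_iff[OF t, of c 0] by simp
  have "f \<in> subfield_set hull (range \<iota> \<union> {t, u})" using gen by (simp add: field_adjoin_def)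
  then show ?thesis
  proof (rule hull_induct)
    fix h assume "h \<in> range \<iota> \<union> {t, u}"
    moreover have "?P (\<iota> c)" for c
      by (intro exI[of _ "[:c:]"] exI[of _ "0 :: 'k poly"] exI[of _ "1 :: 'k poly"]) simp
    moreover have "?P t"
      by (intro exI[of _ "[:0, 1:]"] exI[of _ "0 :: 'k poly"] exI[of _ "1 :: 'k poly"]) simp
    moreover have "?P u"
      by (intro exI[of _ "1 :: 'k poly"] exI[of _ "0 :: 'k poly"]) simp
    ultimately show "?P h" by auto
  next
    have "?P 1"
      by (intro exI[of _ "1 :: 'k poly"] exI[of _ "0 :: 'k poly"]) simp
    moreover have "?P (f - h) \<and> ?P (f * h)" if fh: "?P f" "?P h" for f h
    proof -
      obtain a b c a' b' c' where c: "c \<noteq> 0" "c' \<noteq> 0"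
        and f: "f = (eval_over \<iota> a t + eval_over \<iota> b t * u) / eval_over \<iota> c t"
        and h: "h = (eval_over \<iota> a' t + eval_over \<iota> b' t * u) / eval_over \<iota> c' t"
        using fh by blast
      have nz: "eval_over \<iota> c t \<noteq> 0" "eval_over \<iota> c' t \<noteq> 0" using c ev0 by auto
      have "f - h = (eval_over \<iota> (a * c' - a' * c) t + eval_over \<iota> (b * c' - b' * c) t * u) / eval_over \<iota> (c * c') t"
        unfolding f h using nz by (simp add: eval_over_hom field_simps)
      moreover have "f * h = (eval_over \<iota> (a * a' + b * b' * D) t + eval_over \<iota> (a * b' + a' * b) t * u) / eval_over \<iota> (c * c') t"
        unfolding f h using nz by (simp add: eval_over_hom u[symmetric] power2_eq_square field_simps)
      moreover have "c * c' \<noteq> 0" using c by simp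
      ultimately show ?thesis by blast
    qed
    moreover have "?P (inverse f)" if f: "?P f" for f
    proof (cases "f = 0")
      case False
      obtain a b c where c: "c \<noteq> 0"
        and f: "f = (eval_over \<iota> a t + eval_over \<iota> b t * u) / eval_over \<iota> c t"
        using f by blast
      let ?n = "a\<^sup>2 - b\<^sup>2 * D"
      have nz: "eval_over \<iota> a t + eval_over \<iota> b t * u \<noteq> 0" "eval_over \<iota> c t \<noteq> 0"
        using False c f ev0 by auto
      then have ab: "\<not> (a = 0 \<and> b = 0)" by auto
      then have nz': "eval_over \<iota> a t - eval_over \<iota> b t * u \<noteq> 0"
        using quadratic_independent[OF t sq deg u, of a "- b"] by (auto simp: eval_over_uminus)
      have N: "eval_over \<iota> ?n t = (eval_over \<iota> a t + eval_over \<iota> b t * u) * (eval_over \<iota> a t - eval_over \<iota> b t * u)"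
        by (simp add: eval_over_hom u[symmetric] power2_eq_square algebra_simps)
      have "eval_over \<iota> ?n t \<noteq> 0" unfolding N using nz nz' by simp
      then have "?n \<noteq> 0" using ev0 by blast
      moreover have "inverse f = (eval_over \<iota> (c * a) t + eval_over \<iota> (- c * b) t * u) / eval_over \<iota> ?n t"
      proof -
        have "eval_over \<iota> (c * a) t + eval_over \<iota> (- c * b) t * u
          = eval_over \<iota> c t * (eval_over \<iota> a t - eval_over \<iota> b t * u)"
          by (simp add: eval_over_hom algebra_simps)
        then show ?thesis unfolding N f using nz nz' by simp
      qed
      ultimately show ?thesis by blast
    qed (use \<open>?P f\<close> in simp)
    ultimately show "subfield_set {f. ?P f}"
      unfolding subfield_set_def mem_Collect_eq by blast
  qed
qed

text \<open>The quotient rule prescribes d on each fraction. Equal fractions agree after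
  cross-multiplication, and the rule is insensitive to a common factor of numerator and denominator,
  so d is well defined.\<close>

lemma (in field_embedding) quadratic_derivation_exists:
  fixes D :: "'k poly"
  assumes two: "(2::'k) \<noteq> 0" and u: "u\<^sup>2 = eval_over \<iota> D t"
    and indep: "\<And>a b. eval_over \<iota> a t + eval_over \<iota> b t * u = 0 \<Longrightarrow> a = 0 \<and> b = 0"
    and gen: "\<And>f. \<exists>a b c. c \<noteq> 0 \<and> f = (eval_over \<iota> a t + eval_over \<iota> b t * u) / eval_over \<iota> c t"
  obtains d where "derivation_over \<iota> d" "d t = u"
proof -
  let ?ev = "\<lambda>p. eval_over \<iota> p t"
  define N where "N a b = ?ev a + ?ev b * u" for a b
  \<comment> \<open>\<open>H\<close> is the value that u^2 = D(t) and d t = u force for d u.\<close>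
  define H where "H = ?ev (pderiv D) / 2"
  \<comment> \<open>\<open>\<delta> a b\<close> is to be d of the numerator \<open>N a b\<close>,
    and \<open>\<Delta> a b c\<close> applies the quotient rule.\<close>
  define \<delta> where "\<delta> a b = ?ev (pderiv a) * u + ?ev (pderiv b) * u\<^sup>2 + ?ev b * H" for a b
  define \<Delta> where "\<Delta> a b c = (\<delta> a b * ?ev c - N a b * (?ev (pderiv c) * u)) / ?ev c ^ 2" for a b c
  have "(2::'f) \<noteq> 0" using two emb_two emb_eq_0_iff by metis
  then have H2: "?ev (pderiv D) = 2 * H" by (simp add: H_def)
  have ev0: "?ev c = 0 \<longleftrightarrow> c = 0" for c using indep[of c 0] by auto
  have N_eq: "N a b = N a' b' \<Longrightarrow> a = a' \<and> b = b'" for a b a' b'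
    using indep[of "a - a'" "b - b'"] by (simp add: N_def eval_over_hom algebra_simps)
  have N_mult: "N (a * a' + b * b' * D) (a * b' + a' * b) = N a b * N a' b'" for a b a' b'
    by (simp add: N_def eval_over_hom u[symmetric] power2_eq_square algebra_simps)
  have \<delta>_mult: "\<delta> (a * a' + b * b' * D) (a * b' + a' * b) = \<delta> a b * N a' b' + N a b * \<delta> a' b'" for a b a' b'
    by (simp add: \<delta>_def N_def eval_over_hom pderiv_mult pderiv_add H2 u[symmetric] power2_eq_square algebra_simps)
  have N_scale: "N (a * e) (b * e) = N a b * ?ev e" for a b e
    by (simp add: N_def eval_over_hom algebra_simps)
  have \<delta>_scale: "\<delta> (a * e) (b * e) = \<delta> a b * ?ev e + N a b * (?ev (pderiv e) * u)" for a b e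
    using \<delta>_mult[of a e b 0] by (simp add: N_def \<delta>_def mult.commute)
  have \<Delta>_scale: "\<Delta> (a * e) (b * e) (c * e) = \<Delta> a b c" if "c \<noteq> 0" "e \<noteq> 0" for a b c e
    using that unfolding \<Delta>_def N_scale \<delta>_scale
    by (simp add: eval_over_hom pderiv_mult ev0 field_simps power2_eq_square)
  have \<Delta>_cong: "\<Delta> a b c = \<Delta> a' b' c'"
    if "c \<noteq> 0" "c' \<noteq> 0" and eq: "N a b / ?ev c = N a' b' / ?ev c'" for a b c a' b' c'
  proof -
    have "N (a * c') (b * c') = N (a' * c) (b' * c)"
      using eq that(1,2) unfolding N_scale by (simp add: field_simps ev0)
    then have "a * c' = a' * c" "b * c' = b' * c" using N_eq by blast+
    then show ?thesis using \<Delta>_scale[OF that(1,2), of a b] \<Delta>_scale[OF that(2,1), of a' b']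
      by (simp add: mult.commute)
  qed
  \<comment> \<open>By \<open>\<Delta>_cong\<close> all candidates for \<open>z\<close> agree,
    whichever fraction is picked.\<close>
  define d where "d f = (SOME z. \<exists>a b c. c \<noteq> 0 \<and> f = N a b / ?ev c \<and> z = \<Delta> a b c)" for f
  have d_eq: "d (N a b / ?ev c) = \<Delta> a b c" if "c \<noteq> 0" for a b c
    unfolding d_def
  proof (rule some_equality)
    show "\<exists>a' b' c'. c' \<noteq> 0 \<and> N a b / ?ev c = N a' b' / ?ev c' \<and> \<Delta> a b c = \<Delta> a' b' c'"
      using that by blast
  next
    fix z assume "\<exists>a' b' c'. c' \<noteq> 0 \<and> N a b / ?ev c = N a' b' / ?ev c' \<and> z = \<Delta> a' b' c'"
    then show "z = \<Delta> a b c" using \<Delta>_cong that by metis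
  qed
  have rep: "\<exists>a b c. c \<noteq> 0 \<and> f = N a b / ?ev c" for f using gen by (simp add: N_def)
  have "derivation_over \<iota> d"
  proof unfold_locales
    fix c
    have "\<iota> c = N [:c:] 0 / ?ev 1" by (simp add: N_def)
    then show "d (\<iota> c) = 0" using d_eq[of 1 "[:c:]" 0]
      by (simp add: \<Delta>_def \<delta>_def N_def pderiv_pCons)
  next
    fix f h
    obtain a b c a' b' c' where c: "c \<noteq> 0" "c' \<noteq> 0" and f: "f = N a b / ?ev c" and h: "h = N a' b' / ?ev c'"
      using rep by metis
    have nz: "?ev c \<noteq> 0" "?ev c' \<noteq> 0" "c * c' \<noteq> 0" using c ev0 by auto
    have "f + h = N (a * c' + a' * c) (b * c' + b' * c) / ?ev (c * c')"
      unfolding f h using nz by (simp add: N_def eval_over_hom field_simps)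
    then have "d (f + h) = \<Delta> (a * c' + a' * c) (b * c' + b' * c) (c * c')"
      using d_eq[OF nz(3)] by simp
    also have "\<dots> = \<Delta> (a * c') (b * c') (c * c') + \<Delta> (a' * c) (b' * c) (c' * c)"
      by (simp add: \<Delta>_def \<delta>_def N_def eval_over_hom pderiv_add add_divide_distrib[symmetric] algebra_simps)
    also have "\<dots> = d f + d h" unfolding f h using c by (simp add: \<Delta>_scale d_eq)
    finally show "d (f + h) = d f + d h" .
    have "f * h = N (a * a' + b * b' * D) (a * b' + a' * b) / ?ev (c * c')"
      unfolding f h N_mult by (simp add: eval_over_hom)
    then have "d (f * h) = \<Delta> (a * a' + b * b' * D) (a * b' + a' * b) (c * c')"
      using d_eq[OF nz(3)] by simp
    also have "\<dots> = \<Delta> a b c * (N a' b' / ?ev c') + (N a b / ?ev c) * \<Delta> a' b' c'"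
      unfolding \<Delta>_def N_mult \<delta>_mult using nz
      by (simp add: eval_over_hom pderiv_mult field_simps power2_eq_square)
    also have "\<dots> = d f * h + f * d h" unfolding f h using c by (simp add: d_eq)
    finally show "d (f * h) = d f * h + f * d h" .
  qed
  moreover have "d t = u"
    using d_eq[of 1 "[:0, 1:]" 0] by (simp add: \<Delta>_def \<delta>_def N_def pderiv_pCons)
  ultimately show ?thesis using that by blast
qed

lemma quadratic_chart_exists:
  fixes \<iota> :: "'k::field \<Rightarrow> 'f::field"
  assumes emb: "field_embedding \<iota>" and two: "(2::'k) \<noteq> 0"
    and H: "hyperelliptic_presentation \<iota> g D t u"
  obtains d where "quadratic_chart \<iota> d D t u"
proof -
  interpret field_embedding \<iota> by (rule emb)
  have t: "transcendental_over \<iota> t" and sq: "comaximal D (pderiv D)"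
    and deg: "Polynomial.degree D > 0" and u: "u\<^sup>2 = eval_over \<iota> D t"
    and gen: "field_adjoin \<iota> {t, u} = UNIV"
    using H separable_poly_comaximal unfolding hyperelliptic_presentation_def by auto
  obtain d where d: "derivation_over \<iota> d" "d t = u"
    using quadratic_derivation_exists[OF two u quadratic_independent[OF t sq deg u]
        quadratic_generated[OF t sq deg u gen]] by blast
  interpret derivation_over \<iota> d by (rule d)
  have "quadratic_chart \<iota> d D t u"
    using quadratic_independent[OF t sq deg u] quadratic_generated[OF t sq deg u gen]
    by unfold_locales (use two sq u d in blast)+
  then show ?thesis by (rule that)
qed

lemma reciprocal_eq_0_iff:
  "Polynomial.degree P \<le> n \<Longrightarrow> reciprocal n P = 0 \<longleftrightarrow> P = 0"
proof
  assume deg: "Polynomial.degree P \<le> n" and "reciprocal n P = 0"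
  then have "Polynomial.coeff P (n - j) = 0" if "j \<le> n" for j
    using coeff_reciprocal[of n P j] that by simp
  from this[of "n - Polynomial.degree P"] deg show "P = 0" by simp
qed (simp add: reciprocal_def homogenize_def)

context quadratic_chart
begin

lemma t_nonzero: "t \<noteq> 0"
  by (rule transcendental_over_nonzero[OF t_transcendental])

lemma ev_eq_reciprocal:
  "Polynomial.degree a \<le> m \<Longrightarrow> eval_over \<iota> a (1 / t) = ev (reciprocal m a) / t ^ m"
  using eval_over_reciprocal[of a m t] t_nonzero by simp

text \<open>Since d(1/t) = -u/t^2, the factor -(1/t)^(g-1) is the one that sends 1/t to the new
  square root u/t^(g+1).\<close>

lemma chart_at_infinity:
  assumes deg: "Polynomial.degree D \<le> 2 * g + 2" "2 * g + 1 \<le> Polynomial.degree D" and g: "g > 0"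
  shows "quadratic_chart \<iota> (\<lambda>f. - ((1 / t) ^ (g - 1)) * d f) (reciprocal (2 * g + 2) D) (1 / t) (u / t ^ (g + 1))"
proof unfold_locales
  show "(2::'k) \<noteq> 0" by (rule two_nonzero)
  show "comaximal (reciprocal (2 * g + 2) D) (pderiv (reciprocal (2 * g + 2) D))"
    using comaximal_reciprocal[OF t_transcendental squarefree_D deg(1)] deg(2) by simp
  show "(u / t ^ (g + 1))\<^sup>2 = eval_over \<iota> (reciprocal (2 * g + 2) D) (1 / t)"
    by (rule reciprocal_square[OF deg(1) t_nonzero u_square])
  have "t ^ (g + 1) = t ^ (g - 1) * t\<^sup>2" using g by (simp flip: power_add)
  then show "- ((1 / t) ^ (g - 1)) * d (1 / t) = u / t ^ (g + 1)"
    using t_nonzero by (simp add: d_divide d_1 d_t power_divide)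
next
  fix a b
  assume eq: "eval_over \<iota> a (1 / t) + eval_over \<iota> b (1 / t) * (u / t ^ (g + 1)) = 0"
  define m where "m = max (Polynomial.degree a) (Polynomial.degree b)"
  have "ev (reciprocal m a) / t ^ m + ev (reciprocal m b) / t ^ m * (u / t ^ (g + 1)) = 0"
    using eq ev_eq_reciprocal[of a m] ev_eq_reciprocal[of b m] by (simp add: m_def)
  then have "ev ([:0, 1:] ^ (g + 1) * reciprocal m a) + ev (reciprocal m b) * u = 0"
    using t_nonzero by (simp add: eval_over_hom field_simps)
  from independent[OF this] show "a = 0 \<and> b = 0"
    by (simp add: reciprocal_eq_0_iff m_def)
next
  fix f
  obtain a b c where c: "c \<noteq> 0" and f: "f = (ev a + ev b * u) / ev c" using generated by blast
  define m where "m = Polynomial.degree a + Polynomial.degree b + Polynomial.degree c"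
  have rev: "ev p = t ^ m * eval_over \<iota> (reciprocal m p) (1 / t)" if "Polynomial.degree p \<le> m" for p
    using eval_over_reciprocal[OF that, of "1 / t"] t_nonzero by (simp add: power_divide)
  \<comment> \<open>At 1/t the value of \<open>?X\<close> is 1/t^(g+1); expanding the fraction by it
    turns u into the new square root.\<close>
  let ?X = "[:0, 1:] ^ (g + 1) :: 'k poly"
  have c': "eval_over \<iota> (reciprocal m c) (1 / t) \<noteq> 0" using rev[of c] c by (auto simp: m_def ev_eq_0_iff)
  have "f = (eval_over \<iota> (reciprocal m a) (1 / t) + eval_over \<iota> (reciprocal m b) (1 / t) * u)
      / eval_over \<iota> (reciprocal m c) (1 / t)"
    unfolding f using rev[of a] rev[of b] rev[of c] t_nonzero c'
    by (simp add: m_def field_simps)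
  also have "\<dots> = (eval_over \<iota> (?X * reciprocal m a) (1 / t) + eval_over \<iota> (reciprocal m b) (1 / t) * (u / t ^ (g + 1)))
      / eval_over \<iota> (?X * reciprocal m c) (1 / t)"
  proof -
    have X: "eval_over \<iota> (?X * p) (1 / t) = eval_over \<iota> p (1 / t) / t ^ (g + 1)" for p
      by (simp add: eval_over_hom power_divide)
    show ?thesis unfolding X using t_nonzero
      by (simp add: add_divide_distrib[symmetric] del: power_Suc)
  qed
  finally have "f = (eval_over \<iota> (?X * reciprocal m a) (1 / t) + eval_over \<iota> (reciprocal m b) (1 / t) * (u / t ^ (g + 1)))
      / eval_over \<iota> (?X * reciprocal m c) (1 / t)" .
  moreover have "?X * reciprocal m c \<noteq> 0"
    using c by (simp add: reciprocal_eq_0_iff m_def)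
  ultimately show "\<exists>a b c. c \<noteq> 0 \<and> f = (eval_over \<iota> a (1 / t) + eval_over \<iota> b (1 / t) * (u / t ^ (g + 1))) / eval_over \<iota> c (1 / t)"
    by blast
qed (simp_all add: d_emb d_add d_mult algebra_simps)

text \<open>The coordinates in the two charts are compared. Up to sign, T^(m+2) a and T^(m+2) b
  equal T^(g+1) and 1 times polynomials of degree at most m, so b = 0 and deg a < g.\<close>

lemma differential_polynomial:
  assumes degD: "Polynomial.degree D \<le> 2 * g + 2" "2 * g + 1 \<le> Polynomial.degree D"
    and E: "comaximal E (pderiv E)"
    and deg: "Polynomial.degree E \<le> 2 * g + 2" "2 * g + 1 \<le> Polynomial.degree E"
    and y: "y\<^sup>2 = eval_over \<iota> E x" "y \<noteq> 0" and x0: "x \<noteq> 0" and i: "i < g"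
  obtains A where "x ^ i * d x / y = ev A" "Polynomial.degree A < g"
proof -
  interpret inf: quadratic_chart \<iota> "\<lambda>f. - ((1 / t) ^ (g - 1)) * d f" "reciprocal (2 * g + 2) D" "1 / t" "u / t ^ (g + 1)"
    by (rule chart_at_infinity[OF degD]) (use i in simp)
  define h where "h = x ^ i * d x / y"
  have "h \<in> R" unfolding h_def by (rule differential_in_R[OF E deg y x0 i])
  then obtain a b where ab: "h = ev a + ev b * u" by (rule RE)
  \<comment> \<open>The chart at infinity sees the same differential, up to the factor by which its
    derivation differs from \<open>d\<close>.\<close>
  have "x ^ i * (- ((1 / t) ^ (g - 1)) * d x) / y \<in> inf.R"
    by (rule inf.differential_in_R[OF E deg y x0 i])
  then obtain p q where "x ^ i * (- ((1 / t) ^ (g - 1)) * d x) / y =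
      eval_over \<iota> p (1 / t) + eval_over \<iota> q (1 / t) * (u / t ^ (g + 1))"
    by (rule inf.RE)
  then have pq: "- ((1 / t) ^ (g - 1)) * h = eval_over \<iota> p (1 / t) + eval_over \<iota> q (1 / t) * (u / t ^ (g + 1))"
    unfolding h_def by (simp add: mult_ac)
  define m where "m = max (Polynomial.degree p) (Polynomial.degree q)"
  let ?X = "[:0, 1:] :: 'k poly"
  have tg: "t ^ (g + 1) = t ^ (g - 1) * t\<^sup>2" using i by (simp flip: power_add)
  have "- h / t ^ (g - 1) = ev (reciprocal m p) / t ^ m + ev (reciprocal m q) / t ^ m * (u / t ^ (g + 1))"
    using pq ev_eq_reciprocal[of p m] ev_eq_reciprocal[of q m] by (simp add: m_def power_divide)
  then have "- h * (t ^ m * t\<^sup>2) = ev (reciprocal m p) * t ^ (g + 1) + ev (reciprocal m q) * u"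
    unfolding tg using t_nonzero by (simp add: field_simps)
  then have "ev (- (?X ^ (m + 2) * a)) + ev (- (?X ^ (m + 2) * b)) * u
      = ev (?X ^ (g + 1) * reciprocal m p) + ev (reciprocal m q) * u"
    unfolding ab by (simp add: eval_over_hom power_add power2_eq_square algebra_simps)
  then have e: "- (?X ^ (m + 2) * a) = ?X ^ (g + 1) * reciprocal m p" "- (?X ^ (m + 2) * b) = reciprocal m q"
    using coords_eq by blast+
  have degX: "Polynomial.degree (?X ^ n * r) = n + Polynomial.degree r" if "r \<noteq> 0" for n r
    using that by (simp add: degree_mult_eq degree_power_eq)
  have b0: "b = 0"
  proof (rule ccontr)
    assume "b \<noteq> 0"
    then have "m + 2 \<le> Polynomial.degree (reciprocal m q)"
      unfolding e(2)[symmetric] degree_minus by (subst degX) simp_all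
    with degree_reciprocal_le[of m q] show False by simp
  qed
  have "Polynomial.degree a < g"
  proof (cases "a = 0")
    case False
    have "m + 2 + Polynomial.degree a = Polynomial.degree (?X ^ (g + 1) * reciprocal m p)"
      unfolding e(1)[symmetric] degree_minus by (rule degX[OF False, symmetric])
    also have "\<dots> \<le> g + 1 + m"
      by (rule order_trans[OF degree_mult_le])
        (use degree_reciprocal_le[of m p] in \<open>simp add: degree_power_eq del: power_Suc\<close>)
    finally show ?thesis by simp
  qed (use i in simp)
  with ab b0 show ?thesis using that unfolding h_def by simp
qed

end

section \<open>The relation between two presentations\<close>

text \<open>Bounds instead of exact degrees admit linear polynomials whose leading coefficient is
  0.\<close>

lemma coeff_mult_degree_bounds:
  fixes p q :: "'a::comm_ring_1 poly"
  assumes "Polynomial.degree p \<le> m" "Polynomial.degree q \<le> n"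
  shows "Polynomial.coeff (p * q) (m + n) = Polynomial.coeff p m * Polynomial.coeff q n"
proof -
  have "Polynomial.coeff (p * q) (m + n) = (\<Sum>i\<le>m + n. Polynomial.coeff p i * Polynomial.coeff q (m + n - i))"
    by (rule coeff_mult)
  also have "\<dots> = (\<Sum>i\<in>{m}. Polynomial.coeff p i * Polynomial.coeff q (m + n - i))"
  proof (rule sum.mono_neutral_right)
    show "\<forall>i\<in>{..m + n} - {m}. Polynomial.coeff p i * Polynomial.coeff q (m + n - i) = 0"
    proof
      fix i assume "i \<in> {..m + n} - {m}"
      then have "i > m \<or> m + n - i > n" by auto
      then show "Polynomial.coeff p i * Polynomial.coeff q (m + n - i) = 0"
        using assms coeff_eq_0[of p i] coeff_eq_0[of q "m + n - i"] by auto
    qed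
  qed auto
  finally show ?thesis by simp
qed

lemma degree_linear_power_le: "Polynomial.degree ([:a, b:] ^ i) \<le> i"
  by (rule order_trans[OF degree_power_le]) simp

lemma coeff_linear_power:
  fixes a b :: "'a::comm_ring_1"
  shows "Polynomial.coeff ([:a, b:] ^ i) i = b ^ i"
proof (induction i)
  case (Suc i)
  have "Polynomial.degree [:a, b:] \<le> 1" by simp
  from coeff_mult_degree_bounds[OF this degree_linear_power_le[of a b i]] Suc
  show ?case by simp
qed simp

lemma degree_homogenize_linear_le: "Polynomial.degree (homogenize n P [:a, b:] [:c, e:]) \<le> n"
  unfolding homogenize_def
proof (rule degree_sum_le)
  fix i assume i: "i \<in> {..n}"
  have "Polynomial.degree ([:a, b:] ^ i * [:c, e:] ^ (n - i)) \<le> i + (n - i)"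
    by (rule order_trans[OF degree_mult_le add_mono[OF degree_linear_power_le degree_linear_power_le]])
  then show "Polynomial.degree (Polynomial.smult (Polynomial.coeff P i) ([:a, b:] ^ i * [:c, e:] ^ (n - i))) \<le> n"
    using i by (intro order_trans[OF degree_smult_le]) simp
qed simp

text \<open>The value of (bT + a)/(T + c) at infinity is b, so (T + c)^n P((bT + a)/(T + c)) has
  P(b) at T^n.\<close>

lemma coeff_homogenize_linear:
  assumes "Polynomial.degree P \<le> n"
  shows "Polynomial.coeff (homogenize n P [:a, b:] [:c, 1:]) n = poly P b"
proof -
  have "Polynomial.coeff ([:a, b:] ^ i * [:c, 1:] ^ (n - i)) n = b ^ i" if "i \<le> n" for i
    using coeff_mult_degree_bounds[OF degree_linear_power_le[of a b i] degree_linear_power_le[of c 1 "n - i"]] that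
    by (simp add: coeff_linear_power)
  then have "Polynomial.coeff (homogenize n P [:a, b:] [:c, 1:]) n = (\<Sum>i\<le>n. Polynomial.coeff P i * b ^ i)"
    unfolding homogenize_def coeff_sum by (intro sum.cong) auto
  also have "\<dots> = poly (\<Sum>i\<le>n. Polynomial.monom (Polynomial.coeff P i) i) b"
    by (simp add: poly_sum poly_monom)
  also have "\<dots> = poly P b" by (simp add: poly_as_sum_of_monoms'[OF assms])
  finally show ?thesis .
qed

lemma (in field_embedding) eval_over_pcompose:
  "eval_over \<iota> (pcompose p q) x = eval_over \<iota> p (eval_over \<iota> q x)"
  by (induction p) (simp_all add: pcompose_pCons eval_over_hom)

lemma (in field_embedding) transcendental_over_not_emb:
  "transcendental_over \<iota> x \<Longrightarrow> x \<noteq> \<iota> c"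
  unfolding transcendental_over_def by (auto simp: emb_uminus dest: spec[of _ "[:- c, 1:]"])

lemma two_nonzero_of_CHAR:
  assumes "CHAR('k::field) \<noteq> 2"
  shows "(2::'k) \<noteq> 0"
proof
  assume "(2::'k) = 0"
  then have "of_nat 2 = (0::'k)" by simp
  then have "CHAR('k) dvd 2" using of_nat_eq_0_iff_char_dvd by blast
  then have "CHAR('k) = 1 \<or> CHAR('k) = 2" using prime_nat_iff two_is_prime_nat by blast
  with assms show False by simp
qed

lemma linear_poly: "Polynomial.degree p \<le> 1 \<Longrightarrow> p = [:Polynomial.coeff p 0, Polynomial.coeff p 1:]"
  by (rule poly_eqI) (auto simp: coeff_pCons coeff_eq_0 split: nat.split)

section \<open>From regular differentials to a linear fractional x\<close>

lemma moebius_relation: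
  fixes \<iota> :: "'k::field \<Rightarrow> 'f::field"
  assumes emb: "field_embedding \<iota>" and two: "(2::'k) \<noteq> 0" and g: "g > 1"
    and Ht: "hyperelliptic_presentation \<iota> g D t u"
    and Hx: "hyperelliptic_presentation \<iota> g E x y"
  obtains p0 p1 q0 q1 \<beta> where "p1 * q0 - p0 * q1 \<noteq> 0" "\<beta> \<noteq> 0"
    "x = (\<iota> p1 * t + \<iota> p0) / (\<iota> q1 * t + \<iota> q0)"
    "y = \<iota> \<beta> / (\<iota> q1 * t + \<iota> q0) ^ (g + 1) * u"
proof -
  obtain d where "quadratic_chart \<iota> d D t u" by (rule quadratic_chart_exists[OF emb two Ht])
  then interpret quadratic_chart \<iota> d D t u .
  have degD: "Polynomial.degree D \<le> 2 * g + 2" "2 * g + 1 \<le> Polynomial.degree D"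
    using Ht unfolding hyperelliptic_presentation_def by auto
  have x: "transcendental_over \<iota> x" and sq: "comaximal E (pderiv E)"
    and deg: "Polynomial.degree E \<le> 2 * g + 2" "2 * g + 1 \<le> Polynomial.degree E"
    and y: "y\<^sup>2 = eval_over \<iota> E x" and gen: "field_adjoin \<iota> {x, y} = UNIV"
    using Hx separable_poly_comaximal unfolding hyperelliptic_presentation_def by auto
  have x0: "x \<noteq> 0" by (rule transcendental_over_nonzero[OF x])
  have "E \<noteq> 0" using deg(2) by auto
  then have y0: "y \<noteq> 0" using y x unfolding transcendental_over_def by auto
  \<comment> \<open>If \<open>d x\<close> vanished, then so would \<open>d y\<close>, because 2y is
    nonzero, and with it d on all of F; but d t = u.\<close>
  have dx0: "d x \<noteq> 0"
  proof
    assume dx: "d x = 0"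
    have "2 * y * d y = 0"
      using arg_cong[OF y, of d] by (simp add: power2_eq_square d_mult d_eval_over dx algebra_simps)
    then have "d y = 0" using y0 two_nonzero_in_extension by simp
    with dx have "d t = 0" using d_eq_0_of_generators[OF gen] by blast
    then show False using d_t u_nonzero by simp
  qed
  have "\<exists>A. x ^ i * d x / y = ev A \<and> Polynomial.degree A < g" if "i < g" for i
    using differential_polynomial[OF degD sq deg y y0 x0 that] by blast
  then obtain A where A: "x ^ i * d x / y = ev (A i)" "Polynomial.degree (A i) < g" if "i < g" for i
    by metis
  have A0: "d x / y = ev (A 0)" using A(1)[of 0] g by simp
  then have A0_nz: "A 0 \<noteq> 0" using dx0 y0 by auto
  have Ai: "x ^ i * ev (A 0) = ev (A i)" if "i < g" for i
    using A(1)[OF that] unfolding A0[symmetric] by simp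
  obtain e p q where e: "e \<noteq> 0" "A 1 = e * p" "A 0 = e * q" and pq: "comaximal p q"
    using poly_bezout_cofactors[of "A 1" "A 0"] A0_nz by blast
  have q0: "q \<noteq> 0" using e A0_nz by auto
  have xpq: "x = ev p / ev q"
    using Ai[of 1] g e q0 by (simp add: eval_over_mult ev_eq_0_iff field_simps)
  have p0: "p \<noteq> 0" using xpq x0 by auto
  \<comment> \<open>The largest admissible exponent makes q^(g-1) divide \<open>A 0\<close> and
    p^(g-1) divide \<open>A (g - 1)\<close>, both of degree less than g.\<close>
  have "x ^ (g - 1) * ev (A 0) = ev (A (g - 1))" using Ai g by simp
  then have "ev (p ^ (g - 1) * A 0) = ev (A (g - 1) * q ^ (g - 1))"
    unfolding xpq using q0 by (simp add: eval_over_hom power_divide ev_eq_0_iff field_simps)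
  then have pA: "p ^ (g - 1) * A 0 = A (g - 1) * q ^ (g - 1)" using ev_eq_iff by blast
  have "q ^ (g - 1) dvd A 0"
    by (rule comaximal_dvd_mult[OF comaximal_power[OF comaximal_commute[OF pq], of "g - 1" "g - 1"]])
      (simp only: pA dvd_triv_right)
  then obtain c where c: "A 0 = q ^ (g - 1) * c" by (rule dvdE)
  have c': "A (g - 1) = p ^ (g - 1) * c" using pA q0 by (simp add: c)
  have c0: "c \<noteq> 0" using A0_nz c by auto
  have degs: "(g - 1) * Polynomial.degree q + Polynomial.degree c \<le> g - 1"
    "(g - 1) * Polynomial.degree p + Polynomial.degree c \<le> g - 1"
    using A(2)[of 0, unfolded c] A(2)[of "g - 1", unfolded c'] g c0 p0 q0
    by (simp_all add: degree_mult_eq degree_power_eq)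
  have lin: "Polynomial.degree q \<le> 1" "Polynomial.degree p \<le> 1"
  proof -
    have "(g - 1) * Polynomial.degree q \<le> (g - 1) * 1" "(g - 1) * Polynomial.degree p \<le> (g - 1) * 1"
      using degs by linarith+
    then show "Polynomial.degree q \<le> 1" "Polynomial.degree p \<le> 1" using g by simp_all
  qed
  define q0 q1 p0 p1 where "q0 = Polynomial.coeff q 0" "q1 = Polynomial.coeff q 1"
    "p0 = Polynomial.coeff p 0" "p1 = Polynomial.coeff p 1"
  have q: "q = [:q0, q1:]" and p: "p = [:p0, p1:]"
    using linear_poly lin unfolding q0_q1_p0_p1_def by blast+
  \<comment> \<open>Otherwise x would be a constant. So p or q has degree 1, which exhausts the
    bound g - 1 and leaves \<open>c\<close> constant.\<close>
  have "\<not> (p1 = 0 \<and> q1 = 0)"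
  proof
    assume "p1 = 0 \<and> q1 = 0"
    then have "x = \<iota> (p0 / q0)" using xpq by (simp add: p q emb_divide)
    then show False using transcendental_over_not_emb[OF x] by blast
  qed
  then have "Polynomial.degree q = 1 \<or> Polynomial.degree p = 1" by (auto simp: p q)
  then have "Polynomial.degree c = 0" using degs by auto
  then obtain \<gamma> where \<gamma>: "c = [:\<gamma>:]" by (rule degree_eq_zeroE)
  have \<gamma>0: "\<gamma> \<noteq> 0" using c0 \<gamma> by simp
  \<comment> \<open>The determinant of the substitution, which is the numerator of dx/dt.\<close>
  define w where "w = p1 * q0 - p0 * q1"
  have evq: "ev q = \<iota> q1 * t + \<iota> q0" and evp: "ev p = \<iota> p1 * t + \<iota> p0"
    by (simp_all add: p q algebra_simps)
  have evq0: "ev q \<noteq> 0" using \<open>q \<noteq> 0\<close> by (simp add: ev_eq_0_iff)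
  have "d x = (ev (pderiv p) * u * ev q - ev p * (ev (pderiv q) * u)) / ev q ^ 2"
    unfolding xpq by (simp add: d_divide[OF evq0] d_eval_over d_t)
  also have "\<dots> = \<iota> w * u / ev q ^ 2"
    unfolding evp evq by (simp add: p q pderiv_pCons w_def emb_diff emb_mult algebra_simps)
  finally have dx: "d x = \<iota> w * u / ev q ^ 2" .
  have w0: "w \<noteq> 0" using dx dx0 by auto
  have "y = d x / ev (A 0)" using A0 y0 dx0 by (auto simp: field_simps)
  also have "\<dots> = \<iota> w * u / ev q ^ 2 / (ev q ^ (g - 1) * \<iota> \<gamma>)"
    by (simp add: dx c \<gamma> eval_over_hom)
  also have "\<dots> = \<iota> (w / \<gamma>) / ev q ^ (g + 1) * u"
  proof -
    have "ev q ^ (g + 1) = ev q ^ 2 * ev q ^ (g - 1)" using g by (simp flip: power_add)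
    then show ?thesis by (simp add: emb_divide mult_ac)
  qed
  finally have "y = \<iota> (w / \<gamma>) / (\<iota> q1 * t + \<iota> q0) ^ (g + 1) * u" unfolding evq .
  moreover have "x = (\<iota> p1 * t + \<iota> p0) / (\<iota> q1 * t + \<iota> q0)" using xpq evp evq by simp
  moreover have "w / \<gamma> \<noteq> 0" using w0 \<gamma>0 by simp
  ultimately show ?thesis using that[of p1 q0 p0 q1 "w / \<gamma>"] w0 unfolding w_def by blast
qed

section \<open>Normalisation and the constants \<phi> and \<beta>\<close>

theorem mainTheorem8:
  fixes \<iota> :: "'k::field \<Rightarrow> 'f::field"
    and g :: nat
    and D\<^sub>t D\<^sub>x :: "'k poly"
    and t u x y :: 'f
  assumes "CHAR('k) \<noteq> 2"
    and "field_embedding \<iota>"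
    and "g > 1"
    and "hyperelliptic_presentation \<iota> g D\<^sub>t t u"
    and "hyperelliptic_presentation \<iota> g D\<^sub>x x y"
  shows "(x \<in> ring_adjoin \<iota> t \<longrightarrow>
           (\<exists>\<alpha>\<^sub>0 \<alpha>\<^sub>1. \<alpha>\<^sub>0 \<noteq> 0 \<and> x = \<iota> \<alpha>\<^sub>0 * t + \<iota> \<alpha>\<^sub>1 \<and>
              (\<exists>\<phi>. \<phi> \<noteq> 0 \<and> y = \<iota> \<phi> * u \<and> \<phi>\<^sup>2 = \<alpha>\<^sub>0 ^ Polynomial.degree D\<^sub>x))) \<and>
         (x \<notin> ring_adjoin \<iota> t \<longrightarrow>
           (\<exists>\<alpha>\<^sub>0 \<alpha>\<^sub>1 \<alpha>\<^sub>3. \<alpha>\<^sub>0 * \<alpha>\<^sub>3 - \<alpha>\<^sub>1 \<noteq> 0 \<and>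
              x = (\<iota> \<alpha>\<^sub>0 * t + \<iota> \<alpha>\<^sub>1) / (t + \<iota> \<alpha>\<^sub>3) \<and>
              (\<exists>\<phi> \<beta>. y = \<phi> * u \<and> \<phi> = \<iota> \<beta> / (t + \<iota> \<alpha>\<^sub>3) ^ (g + 1) \<and> \<beta> \<noteq> 0 \<and>
                 \<beta>\<^sup>2 = (if poly D\<^sub>x \<alpha>\<^sub>0 \<noteq> 0 then poly D\<^sub>x \<alpha>\<^sub>0
                       else (\<alpha>\<^sub>1 - \<alpha>\<^sub>0 * \<alpha>\<^sub>3) * poly (D\<^sub>x div [:- \<alpha>\<^sub>0, 1:]) \<alpha>\<^sub>0))))"
proof -
  interpret field_embedding \<iota> by (rule assms(2))
  have t: "transcendental_over \<iota> t" and u: "u\<^sup>2 = eval_over \<iota> D\<^sub>t t"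
    and Dt: "lead_coeff D\<^sub>t = 1" "Polynomial.degree D\<^sub>t = 2 * g + 1 \<or> Polynomial.degree D\<^sub>t = 2 * g + 2"
    using assms(4) unfolding hyperelliptic_presentation_def by auto
  have x: "transcendental_over \<iota> x" and y: "y\<^sup>2 = eval_over \<iota> D\<^sub>x x"
    and Dx: "lead_coeff D\<^sub>x = 1" "Polynomial.degree D\<^sub>x \<le> 2 * g + 2"
    using assms(5) unfolding hyperelliptic_presentation_def by auto
  note ev_inj = transcendental_over_eval_eq_iff[OF t]
  obtain p0 p1 q0 q1 \<beta> where w: "p1 * q0 - p0 * q1 \<noteq> 0" and \<beta>: "\<beta> \<noteq> 0"
    and xm: "x = (\<iota> p1 * t + \<iota> p0) / (\<iota> q1 * t + \<iota> q0)"
    and ym: "y = \<iota> \<beta> / (\<iota> q1 * t + \<iota> q0) ^ (g + 1) * u"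
    by (rule moebius_relation[OF assms(2) two_nonzero_of_CHAR[OF assms(1)] assms(3,4,5)])
  show ?thesis
  \<comment> \<open>A constant denominator turns out to be the case that x is a polynomial in t;
    each branch settles the membership itself.\<close>
  proof (cases "q1 = 0")
    case True
    then have q0: "q0 \<noteq> 0" and p1: "p1 \<noteq> 0" using w by auto
    define \<alpha>\<^sub>0 \<alpha>\<^sub>1 \<phi> where "\<alpha>\<^sub>0 = p1 / q0" "\<alpha>\<^sub>1 = p0 / q0" "\<phi> = \<beta> / q0 ^ (g + 1)"
    note defs = \<alpha>\<^sub>0_\<alpha>\<^sub>1_\<phi>_def
    have nz: "\<alpha>\<^sub>0 \<noteq> 0" "\<phi> \<noteq> 0" using q0 p1 \<beta> by (auto simp: defs)
    have x_eq: "x = \<iota> \<alpha>\<^sub>0 * t + \<iota> \<alpha>\<^sub>1"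
      unfolding xm using True q0 by (simp add: defs emb_divide field_simps)
    have y_eq: "y = \<iota> \<phi> * u"
      unfolding ym using True by (simp add: defs emb_divide emb_power emb_mult)
    have x_ev: "x = eval_over \<iota> [:\<alpha>\<^sub>1, \<alpha>\<^sub>0:] t" using x_eq by (simp add: algebra_simps)
    \<comment> \<open>Both sides are y^2, as polynomials in t; their leading coefficients give
      \<phi>^2.\<close>
    have "eval_over \<iota> (Polynomial.smult (\<phi>\<^sup>2) D\<^sub>t) t = eval_over \<iota> (pcompose D\<^sub>x [:\<alpha>\<^sub>1, \<alpha>\<^sub>0:]) t"
      unfolding eval_over_pcompose x_ev[symmetric] y[symmetric]
      by (simp add: y_eq eval_over_hom emb_power power_mult_distrib u)
    then have "Polynomial.smult (\<phi>\<^sup>2) D\<^sub>t = pcompose D\<^sub>x [:\<alpha>\<^sub>1, \<alpha>\<^sub>0:]" using ev_inj by blast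
    then have "lead_coeff (Polynomial.smult (\<phi>\<^sup>2) D\<^sub>t) = lead_coeff (pcompose D\<^sub>x [:\<alpha>\<^sub>1, \<alpha>\<^sub>0:])"
      by simp
    then have "\<phi>\<^sup>2 = \<alpha>\<^sub>0 ^ Polynomial.degree D\<^sub>x"
      using lead_coeff_comp[of "[:\<alpha>\<^sub>1, \<alpha>\<^sub>0:]" D\<^sub>x] nz Dt(1) Dx(1) by (simp add: lead_coeff_smult)
    moreover have "x \<in> ring_adjoin \<iota> t" unfolding ring_adjoin_def x_ev by blast
    ultimately show ?thesis using x_eq y_eq nz by blast
  next
    case False
    \<comment> \<open>Division by \<open>q1\<close> makes the denominator of x monic; the power
      \<open>q1 ^ (g + 1)\<close> comes from the denominator of y.\<close>
    define \<alpha>\<^sub>0 \<alpha>\<^sub>1 \<alpha>\<^sub>3 b where "\<alpha>\<^sub>0 = p1 / q1" "\<alpha>\<^sub>1 = p0 / q1" "\<alpha>\<^sub>3 = q0 / q1" "b = \<beta> / q1 ^ (g + 1)"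
    note defs = \<alpha>\<^sub>0_\<alpha>\<^sub>1_\<alpha>\<^sub>3_b_def
    have q1: "\<iota> q1 \<noteq> 0" using False by simp
    have b: "b \<noteq> 0" using False \<beta> by (simp add: defs)
    have w': "\<alpha>\<^sub>0 * \<alpha>\<^sub>3 - \<alpha>\<^sub>1 \<noteq> 0"
    proof -
      have "\<alpha>\<^sub>0 * \<alpha>\<^sub>3 - \<alpha>\<^sub>1 = (p1 * q0 - p0 * q1) / q1\<^sup>2"
        using False by (simp add: defs field_simps power2_eq_square)
      then show ?thesis using w False by simp
    qed
    let ?p = "[:\<alpha>\<^sub>1, \<alpha>\<^sub>0:]" and ?q = "[:\<alpha>\<^sub>3, 1:]"
    have q_eq: "\<iota> q1 * t + \<iota> q0 = \<iota> q1 * (t + \<iota> \<alpha>\<^sub>3)" and p_eq: "\<iota> p1 * t + \<iota> p0 = \<iota> q1 * (\<iota> \<alpha>\<^sub>0 * t + \<iota> \<alpha>\<^sub>1)"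
      using q1 by (simp_all add: defs emb_divide field_simps)
    have x_eq: "x = (\<iota> \<alpha>\<^sub>0 * t + \<iota> \<alpha>\<^sub>1) / (t + \<iota> \<alpha>\<^sub>3)"
      unfolding xm q_eq p_eq using q1 by simp
    have y_eq: "y = \<iota> b / (t + \<iota> \<alpha>\<^sub>3) ^ (g + 1) * u"
      unfolding ym q_eq power_mult_distrib by (simp add: defs emb_divide emb_power emb_mult)
    have evp: "eval_over \<iota> ?p t = \<iota> \<alpha>\<^sub>0 * t + \<iota> \<alpha>\<^sub>1" and evq: "eval_over \<iota> ?q t = t + \<iota> \<alpha>\<^sub>3"
      by (simp_all add: algebra_simps)
    have q_nz: "t + \<iota> \<alpha>\<^sub>3 \<noteq> 0" using ev_inj[of ?q 0] unfolding evq by simp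
    have x_ev: "x = eval_over \<iota> ?p t / eval_over \<iota> ?q t" unfolding evp evq by (rule x_eq)
    have hom: "(t + \<iota> \<alpha>\<^sub>3) ^ n * eval_over \<iota> P x = eval_over \<iota> (homogenize n P ?p ?q) t"
      if "Polynomial.degree P \<le> n" for P n
      using eval_over_homogenize[OF that, of ?q t ?p] q_nz unfolding evp evq x_eq[symmetric] by simp
    have bD: "eval_over \<iota> (Polynomial.smult (b\<^sup>2) D\<^sub>t) t = (t + \<iota> \<alpha>\<^sub>3) ^ (2 * g + 2) * eval_over \<iota> D\<^sub>x x"
    proof -
      have "(t + \<iota> \<alpha>\<^sub>3) ^ (2 * g + 2) = ((t + \<iota> \<alpha>\<^sub>3) ^ (g + 1))\<^sup>2"
        by (simp add: power2_eq_square power_add mult_2)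
      then show ?thesis unfolding y[symmetric] y_eq
        using q_nz by (simp add: power_mult_distrib power_divide eval_over_hom emb_power u)
    qed
    have "b\<^sup>2 = (if poly D\<^sub>x \<alpha>\<^sub>0 \<noteq> 0 then poly D\<^sub>x \<alpha>\<^sub>0
      else (\<alpha>\<^sub>1 - \<alpha>\<^sub>0 * \<alpha>\<^sub>3) * poly (D\<^sub>x div [:- \<alpha>\<^sub>0, 1:]) \<alpha>\<^sub>0)"
    proof (cases "poly D\<^sub>x \<alpha>\<^sub>0 = 0")
      case False
      have "Polynomial.smult (b\<^sup>2) D\<^sub>t = homogenize (2 * g + 2) D\<^sub>x ?p ?q"
        using bD hom[OF Dx(2)] ev_inj by simp
      \<comment> \<open>A nonzero value here forces degree 2g + 2 for \<open>D\<^sub>t\<close>,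
        whose coefficient is then 1.\<close>
      then have c: "b\<^sup>2 * Polynomial.coeff D\<^sub>t (2 * g + 2) = poly D\<^sub>x \<alpha>\<^sub>0"
        using coeff_homogenize_linear[OF Dx(2), of \<alpha>\<^sub>1 \<alpha>\<^sub>0 \<alpha>\<^sub>3] by (metis coeff_smult)
      then have "\<not> Polynomial.degree D\<^sub>t < 2 * g + 2" using False coeff_eq_0 by fastforce
      then have "Polynomial.degree D\<^sub>t = 2 * g + 2" using Dt(2) by auto
      with c Dt(1) False show ?thesis by simp
    next
      case True
      \<comment> \<open>The factor x - \<open>\<alpha>\<^sub>0\<close> cancels one power of t +
        \<open>\<alpha>\<^sub>3\<close> up to a constant, so 2g + 1 and \<open>Q\<close> take over
        from 2g + 2 and \<open>D\<^sub>x\<close>.\<close>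
      define Q where "Q = D\<^sub>x div [:- \<alpha>\<^sub>0, 1:]"
      have DQ: "D\<^sub>x = [:- \<alpha>\<^sub>0, 1:] * Q"
        using True unfolding Q_def by (simp add: poly_eq_0_iff_dvd del: mult_pCons_left)
      have "Q \<noteq> 0" using DQ Dx(1) by auto
      then have "Polynomial.degree D\<^sub>x = 1 + Polynomial.degree Q"
        unfolding DQ by (subst degree_mult_eq) auto
      then have degQ: "Polynomial.degree Q \<le> 2 * g + 1" using Dx(2) by simp
      have "eval_over \<iota> D\<^sub>x x = (x - \<iota> \<alpha>\<^sub>0) * eval_over \<iota> Q x"
        unfolding DQ eval_over_mult by (simp add: emb_uminus)
      moreover have "(t + \<iota> \<alpha>\<^sub>3) * (x - \<iota> \<alpha>\<^sub>0) = \<iota> (\<alpha>\<^sub>1 - \<alpha>\<^sub>0 * \<alpha>\<^sub>3)"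
        unfolding x_eq using q_nz by (simp add: emb_diff emb_mult field_simps)
      ultimately have "(t + \<iota> \<alpha>\<^sub>3) ^ (2 * g + 2) * eval_over \<iota> D\<^sub>x x
        = \<iota> (\<alpha>\<^sub>1 - \<alpha>\<^sub>0 * \<alpha>\<^sub>3) * ((t + \<iota> \<alpha>\<^sub>3) ^ (2 * g + 1) * eval_over \<iota> Q x)"
        by (simp add: mult_ac)
      then have "eval_over \<iota> (Polynomial.smult (b\<^sup>2) D\<^sub>t) t
        = eval_over \<iota> (Polynomial.smult (\<alpha>\<^sub>1 - \<alpha>\<^sub>0 * \<alpha>\<^sub>3) (homogenize (2 * g + 1) Q ?p ?q)) t"
        unfolding bD hom[OF degQ] eval_over_smult[of "\<alpha>\<^sub>1 - \<alpha>\<^sub>0 * \<alpha>\<^sub>3"] .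
      then have eq: "Polynomial.smult (b\<^sup>2) D\<^sub>t
        = Polynomial.smult (\<alpha>\<^sub>1 - \<alpha>\<^sub>0 * \<alpha>\<^sub>3) (homogenize (2 * g + 1) Q ?p ?q)"
        using ev_inj by blast
      \<comment> \<open>The right side of \<open>eq\<close> has degree at most 2g + 1, which selects
        the odd degree for \<open>D\<^sub>t\<close>.\<close>
      have "Polynomial.degree D\<^sub>t \<le> 2 * g + 1"
        using arg_cong[OF eq, of Polynomial.degree] b w'
          degree_homogenize_linear_le[of "2 * g + 1" Q \<alpha>\<^sub>1 \<alpha>\<^sub>0 \<alpha>\<^sub>3 1] by (simp split: if_splits)
      then have "Polynomial.degree D\<^sub>t = 2 * g + 1" using Dt(2) by auto
      then have "b\<^sup>2 = Polynomial.coeff (Polynomial.smult (b\<^sup>2) D\<^sub>t) (2 * g + 1)" using Dt(1) by simp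
      also have "\<dots> = (\<alpha>\<^sub>1 - \<alpha>\<^sub>0 * \<alpha>\<^sub>3) * poly Q \<alpha>\<^sub>0"
        unfolding eq coeff_smult coeff_homogenize_linear[OF degQ] ..
      finally show ?thesis using True by (simp add: Q_def)
    qed
    moreover have "x \<notin> ring_adjoin \<iota> t"
    proof
      assume "x \<in> ring_adjoin \<iota> t"
      then obtain P where P: "x = eval_over \<iota> P t" unfolding ring_adjoin_def by blast
      \<comment> \<open>The linear denominator times \<open>P\<close> has degree at most 1, so
        \<open>P\<close> and hence x would be constant.\<close>
      have "eval_over \<iota> (P * ?q) t = eval_over \<iota> ?p t"
        unfolding eval_over_mult evq P[symmetric] evp x_eq using q_nz by simp
      then have "P * ?q = ?p" using ev_inj by blast
      then have "Polynomial.degree (P * ?q) \<le> 1" by simp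
      moreover have "P \<noteq> 0" using P transcendental_over_nonzero[OF x] by auto
      ultimately have "Polynomial.degree P = 0" by (simp add: degree_mult_eq del: mult_pCons_right)
      then obtain c where "P = [:c:]" by (rule degree_eq_zeroE)
      then show False using P transcendental_over_not_emb[OF x] by simp
    qed
    ultimately show ?thesis using x_eq y_eq b w' by blast
  qed
qed

end
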